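(* Let $k\ge 2$ be an integer and let $\mathcal{I},\mathcal{J}$ be finite subsets of $\Lambda_k$ with $\mathcal{I}\cap\mathcal{J}=\varnothing$. Then the set \[ \mathcal{B}_{\mathcal{I},\mathcal{J}}^{(k)}:=\Big\{n\in\mathbb{Z}_{\ge1}\ \Big|\ \#\big((n^k,(n+1)^k)\cap\mathcal{S}_{\mathcal{I}}\big)=\#\mathcal{I},\ \#\big(((n+1)^k,(n+2)^k)\cap\mathcal{S}_{\mathcal{J}}\big)=\#\mathcal{J},\ (n^k,(n+2)^k)\cap\mathcal{S}_{\Lambda_k\setminus(\mathcal{I}\cup\mathcal{J})}=\varnothing\Big\} \] has positive asymptotic density \[ d(\mathcal{B}_{\mathcal{I},\mathcal{J}}^{(k)})=\prod_{\lambda\in\mathcal{I}\cup\mathcal{J}}\frac{1}{\lambda}\cdot\prod_{\lambda\in\Lambda_k\setminus(\mathcal{I}\cup\mathcal{J})}\Big(1-\frac{2}{\lambda}\Big). \]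
   Context: Let $k\ge2$ be an integer. A positive integer $n$ is $k$-full if $p^k\mid n$ for every prime $p\mid n$. Let $\mathcal{S}_k$ be the set of $k$-full integers that are not perfect $k$th powers. Define \[ \Lambda_k:=\Big\{(b_1^{k+1}b_2^{k+2}\cdots b_{k-1}^{2k-1})^{1/k}\ \Big|\ b_1,\dots,b_{k-1}\in\mathbb{Z}_{\ge1},\ b_1\cdots b_{k-1}\ge2,\ b_1\cdots b_{k-1}\text{ squarefree}\Big\}, \] a set of real numbers $>2$ (every $k$-full integer is uniquely $a^k\lambda^k$ with $a\in\mathbb{Z}_{\ge1}$, $\lambda\in\Lambda_k\cup\{1\}$). For nonempty $\mathcal{I}\subseteq\Lambda_k$ let $\mathcal{S}_{\mathcal{I}}:=\{a^k\lambda^k\mid a\in\mathbb{Z}_{\ge1},\lambda\in\mathcal{I}\}$, and $\mathcal{S}_\varnothing:=\varnothing$; thus $\mathcal{S}_{\Lambda_k}=\mathcal{S}_k$. For a set $\mathcal{A}\subseteq\mathbb{Z}_{\ge1}$, $\#\mathcal{A}(x)$ is the number of elements of $\mathcal{A}$ not exceeding $x$, and the asymptotic density is $d(\mathcal{A}):=\lim_{x\to\infty}\#\mathcal{A}(x)/x$ when the limit exists. (The infinite product converges since $\sum_{\lambda\in\Lambda_k}1/\lambda<\infty$.) *)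

theory Defs
  imports "HOL-Analysis.Analysis" "HOL-Computational_Algebra.Squarefree"
begin

definition Lambda :: "nat \<Rightarrow> real set" where
  "Lambda k = {root k (real (\<Prod>i\<in>{1..k-1}. b i ^ (k + i))) | b :: nat \<Rightarrow> nat.
      (\<forall>i\<in>{1..k-1}. b i \<ge> 1) \<and> (\<Prod>i\<in>{1..k-1}. b i) \<ge> 2 \<and>
      squarefree (\<Prod>i\<in>{1..k-1}. b i)}"

definition S_set :: "nat \<Rightarrow> real set \<Rightarrow> nat set" where
  "S_set k I = {n. \<exists>a::nat. a \<ge> 1 \<and> (\<exists>l\<in>I. real n = (real a * l) ^ k)}"

definition count_upto :: "nat set \<Rightarrow> real \<Rightarrow> nat" where
  "count_upto A x = card {m\<in>A. real m \<le> x}"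

definition has_density :: "nat set \<Rightarrow> real \<Rightarrow> bool" where
  "has_density A d \<longleftrightarrow> ((\<lambda>x. real (count_upto A x) / x) \<longlongrightarrow> d) at_top"

definition has_prod_set :: "('a \<Rightarrow> real) \<Rightarrow> 'a set \<Rightarrow> real \<Rightarrow> bool" where
  "has_prod_set f A P \<longleftrightarrow> ((\<lambda>F. \<Prod>x\<in>F. f x) \<longlongrightarrow> P) (finite_subsets_at_top A)"

definition B_set :: "nat \<Rightarrow> real set \<Rightarrow> real set \<Rightarrow> nat set" where
  "B_set k I J = {n. n \<ge> 1 \<and>
     card {m \<in> S_set k I. n ^ k < m \<and> m < (n+1) ^ k} = card I \<and>
     card {m \<in> S_set k J. (n+1) ^ k < m \<and> m < (n+2) ^ k} = card J \<and>
     {m \<in> S_set k (Lambda k - (I \<union> J)). n ^ k < m \<and> m < (n+2) ^ k} = {}}"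

end

theory Submission
  imports Defs "Jordan_Normal_Form.Schur_Decomposition"
begin

text \<open>
  A multiple of \<open>\<lambda>\<close> falls into a window \<open>(n + c, n + d)\<close> exactly when the fractional part of
  \<open>n / \<lambda>\<close> lies in \<open>(1 - d / \<lambda>, 1 - c / \<lambda>)\<close>. Hence membership of \<open>n\<close> in the set \<open>B\<close> says that, for every
  \<open>\<lambda>\<close> in \<open>\<Lambda>\<^sub>k\<close>, the fractional part of \<open>n / \<lambda>\<close> lies in a prescribed arc, of length \<open>1 / \<lambda>\<close> for
  \<open>\<lambda> \<in> I \<union> J\<close> and \<open>1 - 2 / \<lambda>\<close> otherwise.

  For finitely many \<open>\<lambda>\<close> these conditions are independent by Weyl's theorem, because \<open>1\<close> and the numbers
  \<open>1 / \<lambda>\<close> are linearly independent over the rationals. The latter is proved with a trace: let \<open>\<delta>\<close> be an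
  irrational positive radical with \<open>\<delta>\<^sup>d\<close> rational and \<open>d\<close> minimal. Its minimal polynomial has degree
  at least \<open>d\<close>, as the absolute value of the constant term is a power of \<open>\<delta>\<close>. The trace of
  multiplication by \<open>\<delta>\<close> on a finite-dimensional rational algebra of reals is \<open>\<delta>\<close> times a sum of
  \<open>d\<close>-th roots of unity; were it nonzero, \<open>\<delta>\<close> would lie in the \<open>d\<close>-th cyclotomic field, of degree
  less than \<open>d\<close>. So irrational radicals have trace \<open>0\<close> whereas \<open>1\<close> does not.

  The \<open>\<lambda>\<close> outside a large finite set affect only few \<open>n\<close>: the proportion of \<open>n\<close> within distance \<open>2\<close>
  below one of their multiples is bounded by a constant times the tail of the convergent sum of \<open>1 / \<lambda>\<close>.
\<close>

section \<open>Linear independence of real radicals\<close>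

lemma complex_of_real_of_rat: "complex_of_real (of_rat q) = of_rat q"
proof (cases q)
  case (Fract a b)
  then show ?thesis by (simp add: of_rat_rat)
qed

text \<open>A polynomial \<open>g\<close> of least degree \<open>n\<close> vanishing at
  \<open>x\<close> divides \<open>X^d - c\<close>, so all its complex roots have modulus
  \<open>x\<close>. Up to the leading coefficient its constant term is the product of the negated
  roots, so \<open>x ^ n\<close> is rational and minimality of \<open>d\<close> gives
  \<open>d \<le> n\<close>.\<close>

lemma real_radical_degree_le:
  fixes x :: real and f :: "rat poly"
  assumes "x > 0" "x ^ d \<in> \<rat>" and least: "\<And>e. 0 < e \<Longrightarrow> e < d \<Longrightarrow> x ^ e \<notin> \<rat>"
    and "f \<noteq> 0" "poly (map_poly of_rat f) (complex_of_real x) = 0"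
  shows "d \<le> degree f"
proof (cases "d = 0")
  case False
  then have "d > 0" by simp
  define ev where "ev p = poly (map_poly of_rat p) (complex_of_real x)" for p :: "rat poly"
  define n where "n = (LEAST n. \<exists>p. p \<noteq> 0 \<and> ev p = 0 \<and> degree p = n)"
  have ex: "\<exists>p. p \<noteq> 0 \<and> ev p = 0 \<and> degree p = n"
    unfolding n_def by (rule LeastI_ex) (use assms in \<open>auto simp: ev_def\<close>)
  then obtain g where g: "g \<noteq> 0" "ev g = 0" "degree g = n" by blast
  have nle: "n \<le> degree p" if "p \<noteq> 0" "ev p = 0" for p
    unfolding n_def by (rule Least_le) (use that in blast)
  from \<open>x ^ d \<in> \<rat>\<close> obtain c where c: "x ^ d = of_rat c" by (auto elim: Rats_cases)
  define h where "h = monom (1::rat) d + [:- c:]"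
  define G :: "complex poly" where "G = map_poly of_rat g"
  define H :: "complex poly" where "H = map_poly of_rat h"
  have H_poly: "poly H z = z ^ d - of_rat c" for z
    by (simp add: H_def h_def of_rat_hom.map_poly_hom_add of_rat_hom.map_poly_hom_monom
        of_rat_hom.map_poly_pCons_hom poly_monom of_rat_minus)
  have "poly H (complex_of_real x) = 0"
    using c unfolding H_poly by (metis complex_of_real_of_rat of_real_power right_minus_eq)
  moreover have "H = (H div G) * G + H mod G" by simp
  then have "poly H x = poly (H div G) x * poly G x + poly (H mod G) x"
    by (metis poly_add poly_mult)
  moreover have HG: "map_poly of_rat (h mod g) = H mod G"
    by (simp add: H_def G_def of_rat_hom.map_poly_mod)
  ultimately have "ev (h mod g) = 0" using g by (simp add: ev_def G_def)
  moreover have "degree (h mod g) < n" if "h mod g \<noteq> 0"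
    using degree_mod_less[OF g(1), of h] g that by auto
  ultimately have "h mod g = 0" using nle[of "h mod g"] by linarith
  then have "G dvd H" using HG by (metis map_poly_0 mod_0_imp_dvd)
  have root_norm: "cmod z = x" if "poly G z = 0" for z
  proof -
    have "poly H z = 0" using \<open>G dvd H\<close> that by (auto elim!: dvdE)
    then have "z ^ d = complex_of_real (x ^ d)" by (simp add: H_poly c complex_of_real_of_rat)
    then have "cmod z ^ d = x ^ d"
      using assms(1) by (metis norm_of_real norm_power abs_of_pos zero_less_power)
    then show ?thesis
      using assms(1) \<open>d > 0\<close> by (meson norm_ge_zero less_imp_le power_eq_imp_eq_base)
  qed
  have "G \<noteq> 0" using g(1) by (simp add: G_def)
  then obtain Z where Z: "size Z = degree G" "G = Polynomial.smult (lead_coeff G) (\<Prod>z\<in>#Z. [:- z, 1:])"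
    using alg_closed_imp_factorization by blast
  have degG: "degree G = n" "lead_coeff G = of_rat (lead_coeff g)" "poly G 0 = of_rat (poly g 0)"
    using g(3) by (simp_all add: G_def of_rat_hom.poly_map_poly_0)
  have fact: "poly G z = lead_coeff G * (\<Prod>y\<in>#Z. z - y)" for z
    by (subst Z(2)) (simp add: poly_prod_mset image_mset.compositionality o_def)
  \<comment> \<open>Induction runs over submultisets of \<open>Z\<close>, so that each added element
    is known to be a root of \<open>G\<close> and hence to have modulus \<open>x\<close>.\<close>
  have "cmod (\<Prod>y\<in>#Y. - y) = x ^ size Y" if "Y \<subseteq># Z" for Y
    using that
  proof (induction Y)
    case (add y Y)
    have "y \<in># Z" using add.prems by (simp add: insert_subset_eq_iff)
    then have "poly G y = 0" unfolding fact by (auto simp: prod_mset_zero_iff)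
    then show ?case using add root_norm by (simp add: norm_mult subset_mset.dual_order.trans)
  qed auto
  from this[of Z] have "cmod (poly G 0) = cmod (lead_coeff G) * x ^ n"
    using fact[of 0] Z(1) degG(1) by (simp only: norm_mult diff_0 subset_mset.order_refl)
  then have "\<bar>real_of_rat (poly g 0)\<bar> = \<bar>real_of_rat (lead_coeff g)\<bar> * x ^ n"
    unfolding degG(2,3) by (metis norm_of_real complex_of_real_of_rat)
  moreover have "real_of_rat (lead_coeff g) \<noteq> 0" using g(1) by simp
  ultimately have "x ^ n = \<bar>real_of_rat (poly g 0)\<bar> / \<bar>real_of_rat (lead_coeff g)\<bar>"
    by (simp add: field_simps)
  then have "x ^ n \<in> \<rat>" by simp
  \<comment> \<open>\<open>least\<close> speaks only of positive exponents, and \<open>x ^ 0\<close>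
    is rational for trivial reasons.\<close>
  moreover have "n > 0"
  proof (rule ccontr)
    assume "\<not> n > 0"
    then obtain a where "g = [:a:]" using g(3) degree_eq_zeroE by blast
    then show False using g by (simp add: ev_def of_rat_hom.map_poly_pCons_hom)
  qed
  ultimately have "d \<le> n" using least by (meson not_le)
  then show ?thesis using nle[of f] assms by (simp add: ev_def)
qed simp

section \<open>Traces of matrices and of multiplication operators\<close>

lemma trace_mult_commute:
  fixes A B :: "'a :: comm_semiring_1 mat"
  assumes "A \<in> carrier_mat n n" "B \<in> carrier_mat n n"
  shows "(\<Sum>i<n. (A * B) $$ (i, i)) = (\<Sum>i<n. (B * A) $$ (i, i))"
proof -
  have "(\<Sum>i<n. (A * B) $$ (i, i)) = (\<Sum>i<n. \<Sum>j<n. A $$ (i, j) * B $$ (j, i))"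
    using assms by (intro sum.cong refl) (auto simp: scalar_prod_def atLeast0LessThan)
  also have "\<dots> = (\<Sum>i<n. \<Sum>j<n. B $$ (i, j) * A $$ (j, i))"
    by (subst sum.swap) (simp add: mult.commute)
  also have "\<dots> = (\<Sum>i<n. (B * A) $$ (i, i))"
    using assms by (intro sum.cong refl) (auto simp: scalar_prod_def atLeast0LessThan)
  finally show ?thesis .
qed

text \<open>Schur decomposition: the matrix is similar to a triangular one whose diagonal lists the
  roots of the characteristic polynomial with multiplicity, and similarity preserves the
  trace.\<close>

lemma trace_eq_sum_eigenvalues:
  fixes A :: "complex mat"
  assumes A: "A \<in> carrier_mat n n"
  obtains es where "(\<Sum>i<n. A $$ (i, i)) = sum_list es" "\<And>e. e \<in> set es \<Longrightarrow> eigenvalue A e"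
proof -
  from char_poly_factorized[OF A] obtain es where es: "char_poly A = (\<Prod>a\<leftarrow>es. [:- a, 1:])" by blast
  obtain B P Q where BPQ: "schur_decomposition A es = (B, P, Q)" by (cases "schur_decomposition A es")
  from schur_decomposition[OF A es BPQ] have sim: "similar_mat_wit A B P Q" and diag: "diag_mat B = es"
    by auto
  note S = similar_mat_witD2[OF A sim]
  have "(\<Sum>i<n. A $$ (i, i)) = (\<Sum>i<n. (P * (B * Q)) $$ (i, i))"
    using S by (simp add: assoc_mult_mat[of P n n B n Q n])
  also have "\<dots> = (\<Sum>i<n. (B * Q * P) $$ (i, i))"
    using S by (intro trace_mult_commute) auto
  also have "B * Q * P = B" using S by (simp add: assoc_mult_mat[of B n n Q n P n])
  also have "(\<Sum>i<n. B $$ (i, i)) = sum_list es"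
    using S by (simp add: diag[symmetric] diag_mat_def interv_sum_list_conv_sum_set_nat atLeast0LessThan)
  finally have "(\<Sum>i<n. A $$ (i, i)) = sum_list es" .
  moreover have "eigenvalue A e" if "e \<in> set es" for e
    using that by (auto simp: eigenvalue_root_char_poly[OF A] es poly_prod_list prod_list_zero_iff)
  ultimately show thesis using that by blast
qed

text \<open>The complex numbers as a vector space over the rationals. Working over the complex
  numbers keeps real radicals and roots of unity in one space.\<close>

definition rat_scale :: "rat \<Rightarrow> complex \<Rightarrow> complex" where
  "rat_scale q z = of_rat q * z"

interpretation rat_complex: vector_space rat_scale
  by unfold_locales (simp_all add: rat_scale_def of_rat_add of_rat_mult algebra_simps)

text \<open>The trace of multiplication by \<open>x\<close> on the rational span of
  \<open>B\<close>, computed in the basis \<open>B\<close>. It has this meaning when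
  \<open>B\<close> is finite and independent and its span is stable under \<open>x\<close>.\<close>

definition span_trace :: "complex set \<Rightarrow> complex \<Rightarrow> rat" where
  "span_trace B x = (\<Sum>b\<in>B. rat_complex.representation B (x * b) b)"

text \<open>The \<open>d\<close>-th power of the multiplication operator is the scalar
  \<open>c\<close>, so every eigenvalue of its matrix is a \<open>d\<close>-th root of
  \<open>c\<close>; the trace is the sum of these eigenvalues.\<close>

lemma span_trace_eq_sum_roots:
  assumes B: "finite B" "rat_complex.independent B"
    and stable: "\<And>b. b \<in> B \<Longrightarrow> x * b \<in> rat_complex.span B"
    and pow: "x ^ d = of_rat c"
  obtains es :: "complex list" where "of_rat (span_trace B x) = sum_list es" "\<And>e. e \<in> set es \<Longrightarrow> e ^ d = of_rat c"
proof -
  define n where "n = card B"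
  obtain \<beta> where \<beta>: "bij_betw \<beta> {..<n} B"
    using B(1) ex_bij_betw_nat_finite[OF B(1)] by (auto simp: n_def atLeast0LessThan)
  let ?rep = "rat_complex.representation B"
  \<comment> \<open>The coordinates of \<open>x * \<beta> i\<close> form row \<open>i\<close> rather
    than column \<open>i\<close>; an eigenvector then lists the values of a linear form on the
    basis.\<close>
  define A :: "complex mat" where "A = mat n n (\<lambda>(i, j). of_rat (?rep (x * \<beta> i) (\<beta> j)))"
  have A: "A \<in> carrier_mat n n" by (simp add: A_def)
  obtain es where es: "(\<Sum>i<n. A $$ (i, i)) = sum_list es" "\<And>e. e \<in> set es \<Longrightarrow> eigenvalue A e"
    using trace_eq_sum_eigenvalues[OF A] by blast
  have "of_rat (span_trace B x) = (\<Sum>b\<in>B. of_rat (?rep (x * b) b))"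
    by (simp add: span_trace_def of_rat_sum)
  also have "\<dots> = (\<Sum>i<n. of_rat (?rep (x * \<beta> i) (\<beta> i)))"
    by (rule sum.reindex_bij_betw[OF \<beta>, symmetric])
  also have "\<dots> = sum_list es" using es(1) by (simp add: A_def)
  finally have 1: "of_rat (span_trace B x) = sum_list es" .
  have 2: "e ^ d = of_rat c" if "e \<in> set es" for e
  proof -
    from es(2)[OF that] obtain v where v: "v \<in> carrier_vec n" "v \<noteq> 0\<^sub>v n" "A *\<^sub>v v = e \<cdot>\<^sub>v v"
      using A by (auto simp: eigenvalue_def eigenvector_def)
    \<comment> \<open>The eigenvector, read as a linear form on the span, turns multiplication by \<open>x\<close> into
      multiplication by \<open>e\<close>.\<close>
    define \<phi> :: "complex \<Rightarrow> complex" where "\<phi> u = (\<Sum>j<n. of_rat (?rep u (\<beta> j)) * vec_index v j)" for u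
    have \<phi>_add: "\<phi> (u + w) = \<phi> u + \<phi> w" if "u \<in> rat_complex.span B" "w \<in> rat_complex.span B" for u w
      using that B by (simp add: \<phi>_def rat_complex.representation_add of_rat_add algebra_simps sum.distrib)
    have \<phi>_scale: "\<phi> (rat_scale q u) = of_rat q * \<phi> u" if "u \<in> rat_complex.span B" for u q
      using rat_complex.representation_scale[OF B(2) that, of q]
      by (simp add: \<phi>_def of_rat_mult sum_distrib_left mult.assoc)
    have \<beta>B: "\<beta> i \<in> B" if "i < n" for i using \<beta> that by (auto simp: bij_betw_def)
    have inj: "\<beta> j = \<beta> i \<longleftrightarrow> j = i" if "i < n" "j < n" for i j
      using \<beta> that by (auto simp: bij_betw_def inj_on_def)
    have \<phi>_basis: "\<phi> (\<beta> i) = vec_index v i" if "i < n" for i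
    proof -
      have "\<phi> (\<beta> i) = (\<Sum>j<n. if j = i then vec_index v j else 0)"
        unfolding \<phi>_def using that inj \<beta>B B
        by (intro sum.cong refl) (auto simp: rat_complex.representation_basis)
      then show ?thesis using that by simp
    qed
    have \<phi>_x_basis: "\<phi> (x * \<beta> i) = e * \<phi> (\<beta> i)" if "i < n" for i
    proof -
      have "vec_index (A *\<^sub>v v) i = \<phi> (x * \<beta> i)"
        using that v(1) by (simp add: A_def \<phi>_def scalar_prod_def atLeast0LessThan)
      then show ?thesis using v that by (simp add: \<phi>_basis)
    qed
    \<comment> \<open>Membership in the span is carried through the induction because
      \<open>\<phi>\<close> is known to be linear only there.\<close>
    have "u \<in> rat_complex.span B \<and> x * u \<in> rat_complex.span B \<and> \<phi> (x * u) = e * \<phi> u" if "u \<in> rat_complex.span B" for u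
      using that
    proof (induction rule: rat_complex.span_induct_alt)
      case base
      have "\<phi> 0 = 0" by (simp add: \<phi>_def rat_complex.representation_zero)
      then show ?case by (simp add: rat_complex.span_zero)
    next
      case (step q b u)
      from step(1) \<beta> obtain i where i: "i < n" "b = \<beta> i" by (auto simp: bij_betw_def)
      have b: "b \<in> rat_complex.span B" "x * b \<in> rat_complex.span B"
        using step(1) stable by (auto intro: rat_complex.span_base)
      have qb: "rat_scale q b \<in> rat_complex.span B" "rat_scale q (x * b) \<in> rat_complex.span B"
        using b[THEN rat_complex.span_scale, of q] by simp_all
      have "x * (rat_scale q b + u) = rat_scale q (x * b) + x * u"
        by (simp add: rat_scale_def algebra_simps)
      moreover have "\<phi> (rat_scale q (x * b) + x * u) = e * \<phi> (rat_scale q b + u)"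
        using step(2) b qb \<phi>_x_basis[OF i(1)] i(2) by (simp add: \<phi>_add \<phi>_scale algebra_simps)
      ultimately show ?case using step(2) qb by (auto intro: rat_complex.span_add)
    qed
    then have step: "x * u \<in> rat_complex.span B" "\<phi> (x * u) = e * \<phi> u" if "u \<in> rat_complex.span B" for u
      using that by auto
    have iter: "x ^ m * u \<in> rat_complex.span B \<and> \<phi> (x ^ m * u) = e ^ m * \<phi> u"
      if "u \<in> rat_complex.span B" for m u
      by (induction m) (use that step in \<open>auto simp: mult.assoc\<close>)
    obtain i where i: "i < n" "vec_index v i \<noteq> 0" using v by (metis carrier_vecD eq_vecI index_zero_vec)
    have "of_rat c * \<phi> (\<beta> i) = e ^ d * \<phi> (\<beta> i)"
      using iter[of "\<beta> i" d] \<phi>_scale \<beta>B[OF i(1)] pow by (metis rat_complex.span_base rat_scale_def)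
    then show ?thesis using i by (simp add: \<phi>_basis)
  qed
  from 1 2 that show thesis by blast
qed

text \<open>Each \<open>e\<close> divided by \<open>x\<close> is a \<open>d\<close>-th root of
  unity. If \<open>q\<close> were nonzero, \<open>1 / x\<close> would lie in the span of these
  roots, a ring of rational dimension at most \<open>d - 1\<close>, whereas the degree bound for
  radicals makes the first \<open>d\<close> powers of \<open>1 / x\<close> independent.\<close>

lemma rational_sum_of_radical_conjugates_eq_0:
  fixes x :: real and es :: "complex list"
  assumes x: "x > 0" "x ^ d \<in> \<rat>" and least: "\<And>e. 0 < e \<Longrightarrow> e < d \<Longrightarrow> x ^ e \<notin> \<rat>" and d: "d \<ge> 2"
    and es: "\<And>e. e \<in> set es \<Longrightarrow> e ^ d = complex_of_real x ^ d" and q: "sum_list es = of_rat q"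
  shows "q = 0"
proof (rule ccontr)
  assume "q \<noteq> 0"
  define \<zeta> where "\<zeta> = cis (2 * pi / d)"
  have bij: "bij_betw (\<lambda>j. \<zeta> ^ j) {..<d} {z. z ^ d = 1}"
  proof -
    have "(\<lambda>j. \<zeta> ^ j) = (\<lambda>j. cis (2 * pi * real j / real d))"
      by (intro ext) (simp only: \<zeta>_def Complex.DeMoivre times_divide_eq_right mult.commute)
    with Complex.bij_betw_roots_unity[of d] d show ?thesis by simp
  qed
  then have "\<zeta> ^ 1 \<in> {z. z ^ d = 1}"
    by (rule bij_betwE[THEN bspec]) (use d in simp)
  then have \<zeta>d: "\<zeta> ^ d = 1" by (simp only: mem_Collect_eq power_one_right)
  have "inj_on (\<lambda>j. \<zeta> ^ j) {..<d}" using bij by (rule bij_betw_imp_inj_on)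
  from inj_onD[OF this, of 1 0] have "\<zeta> \<noteq> 1" using d by auto
  have unity: "\<exists>j. w = \<zeta> ^ j" if "w ^ d = 1" for w
    using bij_betw_imp_surj_on[OF bij] that by blast
  \<comment> \<open>The last power \<open>\<zeta> ^ (d - 1)\<close> is omitted: the vanishing
    geometric sum expresses it by the others. This one relation brings the dimension below
    \<open>d\<close>.\<close>
  define Z where "Z = rat_complex.span ((\<lambda>j. \<zeta> ^ j) ` {..<d - 1})"
  have Zpow: "\<zeta> ^ j \<in> Z" for j
  proof -
    have "(\<Sum>i<d. \<zeta> ^ i) = 0" using \<zeta>d \<open>\<zeta> \<noteq> 1\<close> by (simp add: sum_gp_strict)
    moreover have "{..<d} = insert (d - 1) {..<d - 1}" using d by auto
    ultimately have eq: "\<zeta> ^ (d - 1) = - (\<Sum>i<d - 1. \<zeta> ^ i)" by (simp add: eq_neg_iff_add_eq_0)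
    have "\<zeta> ^ i \<in> Z" if "i < d - 1" for i
      unfolding Z_def using that by (auto intro: rat_complex.span_base)
    moreover from this have "\<zeta> ^ (d - 1) \<in> Z" unfolding eq Z_def
      by (intro rat_complex.span_neg rat_complex.span_sum) auto
    moreover have "\<zeta> ^ j = \<zeta> ^ (j mod d)"
      by (metis \<zeta>d mult_1 power_add power_mult power_one mult_div_mod_eq)
    moreover have "j mod d < d - 1 \<or> j mod d = d - 1" using d
      by (metis Suc_diff_1 gr0I less_SucE mod_less_divisor not_numeral_le_zero)
    ultimately show ?thesis by auto
  qed
  have Zmult: "u * w \<in> Z" if "u \<in> Z" "w \<in> Z" for u w
  proof -
    have 1: "\<zeta> ^ j * w \<in> Z" if "w \<in> Z" for w j
      using that unfolding Z_def
    proof (induction rule: rat_complex.span_induct_alt)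
      case (step c x y)
      then obtain i where "x = \<zeta> ^ i" by auto
      then have "\<zeta> ^ j * (rat_scale c x + y) = rat_scale c (\<zeta> ^ (j + i)) + \<zeta> ^ j * y"
        by (simp add: rat_scale_def algebra_simps power_add)
      then show ?case using step(2) Zpow[of "j + i"]
        by (auto simp: Z_def intro: rat_complex.span_add rat_complex.span_scale)
    qed (simp add: rat_complex.span_zero)
    show ?thesis using that(1) unfolding Z_def
    proof (induction rule: rat_complex.span_induct_alt)
      case (step c x y)
      then obtain i where "x = \<zeta> ^ i" by auto
      then have "(rat_scale c x + y) * w = rat_scale c (\<zeta> ^ i * w) + y * w"
        by (simp add: rat_scale_def algebra_simps)
      then show ?case using step(2) 1[OF that(2), of i]
        by (auto simp: Z_def intro: rat_complex.span_add rat_complex.span_scale)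
    qed (simp add: rat_complex.span_zero)
  qed
  \<comment> \<open>Passing to the inverse lets \<open>y * e\<close> be a root of unity and
    \<open>y * q\<close> their sum, so \<open>y\<close> itself is in \<open>Z\<close> after division
    by the rational \<open>q\<close>.\<close>
  define y where "y = inverse x"
  have y: "y > 0" "y ^ d \<in> \<rat>" "\<And>e. 0 < e \<Longrightarrow> e < d \<Longrightarrow> y ^ e \<notin> \<rat>"
    using x least by (auto simp: y_def power_inverse simp del: inverse_eq_divide)
  have "complex_of_real y * e \<in> Z" if "e \<in> set es" for e
  proof -
    have "(complex_of_real y * e) ^ d = 1"
      using es[OF that] x(1) by (simp add: y_def power_mult_distrib field_simps)
    then show ?thesis using unity Zpow by metis
  qed
  then have "complex_of_real y * sum_list es \<in> Z"
    by (induction es) (auto simp: Z_def algebra_simps intro: rat_complex.span_zero rat_complex.span_add)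
  then have "rat_scale (inverse q) (complex_of_real y * sum_list es) \<in> Z"
    unfolding Z_def by (rule rat_complex.span_scale)
  moreover have "rat_scale (inverse q) (complex_of_real y * sum_list es) = complex_of_real y"
    using \<open>q \<noteq> 0\<close> by (simp add: rat_scale_def q of_rat_inverse)
  ultimately have yZ: "complex_of_real y \<in> Z" by simp
  have ypow: "complex_of_real y ^ j \<in> Z" for j
    by (induction j) (use Zpow[of 0] Zmult[OF yZ] in auto)
  have "y \<noteq> 1" using y(3)[of 1] d by auto
  then have inj: "inj_on (\<lambda>j. complex_of_real y ^ j) {..<d}"
    using y(1) by (auto simp: inj_on_def power_inject_exp' simp flip: of_real_power)
  then have card: "card ((\<lambda>j. complex_of_real y ^ j) ` {..<d}) = d" by (simp add: card_image)
  have "card ((\<lambda>j. \<zeta> ^ j) ` {..<d - 1}) \<le> d - 1"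
    by (metis card_image_le card_lessThan finite_lessThan)
  \<comment> \<open>These are \<open>d\<close> distinct elements of a space spanned by at most
    \<open>d - 1\<close> vectors. Their dependence gives the polynomial \<open>f\<close> below, of
    degree less than \<open>d\<close>.\<close>
  then have "rat_complex.dependent ((\<lambda>j. complex_of_real y ^ j) ` {..<d})"
    using rat_complex.independent_span_bound[of "(\<lambda>j. \<zeta> ^ j) ` {..<d - 1}"
        "(\<lambda>j. complex_of_real y ^ j) ` {..<d}"] ypow card d unfolding Z_def by fastforce
  then obtain u where u: "\<exists>v\<in>(\<lambda>j. complex_of_real y ^ j) ` {..<d}. u v \<noteq> 0"
      "(\<Sum>v\<in>(\<lambda>j. complex_of_real y ^ j) ` {..<d}. rat_scale (u v) v) = 0"
    by (subst (asm) rat_complex.dependent_finite) auto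
  define c where "c j = u (complex_of_real y ^ j)" for j
  from u obtain j0 where j0: "j0 < d" "c j0 \<noteq> 0" by (auto simp: c_def)
  have c: "(\<Sum>j<d. of_rat (c j) * complex_of_real y ^ j) = 0"
    using u(2) by (simp add: sum.reindex[OF inj] c_def rat_scale_def)
  define f where "f = (\<Sum>j<d. monom (c j) j)"
  have coeff_f: "coeff f j = (if j < d then c j else 0)" for j
    by (simp add: f_def coeff_sum if_distrib[where f="\<lambda>x. x = _"] sum.If_cases)
  then have "f \<noteq> 0" using j0 by (metis coeff_0)
  moreover have "degree f \<le> d - 1"
    using coeff_f by (intro degree_le) auto
  moreover have "poly (map_poly of_rat f) (complex_of_real y) = (\<Sum>j<d. of_rat (c j) * complex_of_real y ^ j)"
    by (simp add: f_def of_rat_hom.poly_map_poly_eval_poly of_rat_hom.eval_poly_sum of_rat_hom.eval_poly_monom)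
  ultimately show False using real_radical_degree_le[OF y, of f] c d by simp
qed

text \<open>All \<open>\<alpha> i\<close> act on the finite-dimensional algebra spanned by monomials
  with exponents below \<open>k\<close>. Taking traces of the relation, every irrational radical
  contributes 0, while the scalar \<open>r\<close> contributes \<open>r\<close> times the positive
  dimension.\<close>

theorem rational_combination_of_irrational_radicals:
  fixes \<alpha> :: "'i \<Rightarrow> real" and c :: "'i \<Rightarrow> rat"
  assumes fin: "finite S" and k: "k > 0"
    and pos: "\<And>i. i \<in> S \<Longrightarrow> \<alpha> i > 0" and rad: "\<And>i. i \<in> S \<Longrightarrow> \<alpha> i ^ k \<in> \<rat>"
    and irr: "\<And>i. i \<in> S \<Longrightarrow> \<alpha> i \<notin> \<rat>"
    and sum: "(\<Sum>i\<in>S. of_rat (c i) * \<alpha> i) = of_rat r"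
  shows "r = 0"
proof -
  define \<mu> where "\<mu> e = (\<Prod>i\<in>S. complex_of_real (\<alpha> i) ^ e i)" for e :: "'i \<Rightarrow> nat"
  define M where "M = \<mu> ` (S \<rightarrow>\<^sub>E {..<k})"
  have finM: "finite M" unfolding M_def using fin by (intro finite_imageI finite_PiE) auto
  obtain B where B: "B \<subseteq> M" "rat_complex.independent B" "M \<subseteq> rat_complex.span B"
    using rat_complex.maximal_independent_subset by blast
  have finB: "finite B" using B(1) finM by (rule finite_subset)
  have "\<mu> (\<lambda>i\<in>S. 0) = 1" by (simp add: \<mu>_def)
  moreover have "(\<lambda>i\<in>S. 0) \<in> S \<rightarrow>\<^sub>E {..<k}" using k by auto
  ultimately have "1 \<in> M" unfolding M_def by (metis imageI)
  then have "B \<noteq> {}" using B(3) by auto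
  have stableM: "complex_of_real (\<alpha> i) * m \<in> rat_complex.span B" if i: "i \<in> S" and m: "m \<in> M" for i m
  proof -
    from m obtain e where e: "e \<in> S \<rightarrow>\<^sub>E {..<k}" "m = \<mu> e" by (auto simp: M_def)
    have split: "\<mu> e = complex_of_real (\<alpha> i) ^ e i * (\<Prod>j\<in>S - {i}. complex_of_real (\<alpha> j) ^ e j)" for e
      unfolding \<mu>_def using fin i by (simp add: prod.remove)
    show ?thesis
    proof (cases "e i + 1 < k")
      case True
      define e' where "e' = e(i := e i + 1)"
      have "complex_of_real (\<alpha> i) * m = \<mu> e'"
        unfolding e(2) split[of e] split[of e'] by (auto simp: e'_def intro!: prod.cong)
      moreover have "e' \<in> S \<rightarrow>\<^sub>E {..<k}" using e(1) i True by (auto simp: e'_def PiE_iff extensional_def)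
      ultimately show ?thesis using B(3) by (auto simp: M_def)
    next
      case False
      then have ei: "Suc (e i) = k" using e(1) i by (force simp: PiE_iff)
      \<comment> \<open>At the top exponent \<open>k - 1\<close> one more factor completes
        \<open>\<alpha> i ^ k\<close>, a rational number, so the exponent wraps around to 0.\<close>
      define e' where "e' = e(i := 0)"
      obtain q where q: "\<alpha> i ^ k = of_rat q" using rad[OF i] by (auto elim: Rats_cases)
      have "complex_of_real (\<alpha> i) * m = complex_of_real (\<alpha> i ^ k) * (\<Prod>j\<in>S - {i}. complex_of_real (\<alpha> j) ^ e j)"
        unfolding e(2) split[of e] ei[symmetric] by simp
      also have "\<dots> = rat_scale q (\<mu> e')"
        unfolding q split[of e'] by (auto simp: e'_def rat_scale_def complex_of_real_of_rat intro!: prod.cong)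
      finally have "complex_of_real (\<alpha> i) * m = rat_scale q (\<mu> e')" .
      moreover have "e' \<in> S \<rightarrow>\<^sub>E {..<k}" using e(1) i k by (auto simp: e'_def PiE_iff extensional_def)
      then have "\<mu> e' \<in> rat_complex.span B" using B(3) by (auto simp: M_def)
      ultimately show ?thesis by (simp add: rat_complex.span_scale)
    qed
  qed
  have stable: "complex_of_real (\<alpha> i) * b \<in> rat_complex.span B" if "i \<in> S" "b \<in> B" for i b
    using that stableM B(1) by blast
  have trace_0: "span_trace B (complex_of_real (\<alpha> i)) = 0" if i: "i \<in> S" for i
  proof -
    define d where "d = (LEAST d. 0 < d \<and> \<alpha> i ^ d \<in> \<rat>)"
    have d: "0 < d" "\<alpha> i ^ d \<in> \<rat>"
      using LeastI[of "\<lambda>d. 0 < d \<and> \<alpha> i ^ d \<in> \<rat>" k] k rad[OF i] by (simp_all add: d_def)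
    have least: "\<alpha> i ^ e \<notin> \<rat>" if "0 < e" "e < d" for e
      using not_less_Least[of e "\<lambda>d. 0 < d \<and> \<alpha> i ^ d \<in> \<rat>"] that by (simp add: d_def)
    have "d \<noteq> 1" using d(2) irr[OF i] by auto
    then have d2: "d \<ge> 2" using d(1) by simp
    obtain q where q: "\<alpha> i ^ d = of_rat q" using d(2) by (auto elim: Rats_cases)
    have pow: "complex_of_real (\<alpha> i) ^ d = of_rat q"
      using q by (metis complex_of_real_of_rat of_real_power)
    obtain es :: "complex list" where es: "of_rat (span_trace B (complex_of_real (\<alpha> i))) = sum_list es"
        "\<And>e. e \<in> set es \<Longrightarrow> e ^ d = of_rat q"
      using span_trace_eq_sum_roots[OF finB B(2) stable[OF i] pow] by blast
    show ?thesis
      by (rule rational_sum_of_radical_conjugates_eq_0[OF pos[OF i] d(2) least d2, of es]) (use es pow in auto)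
  qed
  have comb: "of_rat r * b = (\<Sum>i\<in>S. rat_scale (c i) (complex_of_real (\<alpha> i) * b))" for b
  proof -
    have "complex_of_rat r = (\<Sum>i\<in>S. of_rat (c i) * complex_of_real (\<alpha> i))"
      unfolding complex_of_real_of_rat[symmetric] sum[symmetric] by simp
    then show ?thesis by (simp add: rat_scale_def sum_distrib_right mult.assoc)
  qed
  \<comment> \<open>The trace of multiplication by \<open>r\<close> is evaluated twice: as a scalar
    operator here, and through \<open>comb\<close> in the chain that follows.\<close>
  have "of_nat (card B) * r = (\<Sum>b\<in>B. rat_complex.representation B (rat_scale r b) b)"
  proof -
    have "rat_complex.representation B (rat_scale r b) b = r" if "b \<in> B" for b
      using that B(2) by (simp add: rat_complex.representation_scale rat_complex.representation_basis
          rat_complex.span_base)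
    then show ?thesis by simp
  qed
  also have "\<dots> = (\<Sum>b\<in>B. \<Sum>i\<in>S. c i * rat_complex.representation B (complex_of_real (\<alpha> i) * b) b)"
    using stable B(2)
    by (intro sum.cong refl, subst rat_scale_def, subst comb)
      (simp add: rat_complex.representation_sum rat_complex.representation_scale rat_complex.span_scale)
  also have "\<dots> = (\<Sum>i\<in>S. c i * span_trace B (complex_of_real (\<alpha> i)))"
    by (subst sum.swap) (simp add: span_trace_def sum_distrib_left)
  also have "\<dots> = 0" by (simp add: trace_0)
  finally show ?thesis using finB \<open>B \<noteq> {}\<close> by simp
qed

section \<open>Arithmetic of the set \<open>\<Lambda>\<^sub>k\<close>\<close>

text \<open>The prime valuations of \<open>b_1^(k+1) ... b_(k-1)^(2k-1)\<close> with squarefree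
  product of the \<open>b_i\<close>. The allowed exponents 0 and \<open>k + 1\<close>, ...,
  \<open>2 * k - 1\<close> are pairwise incongruent mod \<open>k\<close>.\<close>

definition reduced_full :: "nat \<Rightarrow> nat \<Rightarrow> bool" where
  "reduced_full k N \<longleftrightarrow> N > 0 \<and>
     (\<forall>p. prime p \<longrightarrow> multiplicity p N = 0 \<or> k < multiplicity p N \<and> multiplicity p N < 2 * k)"

text \<open>A factor that is a \<open>k\<close>-th power changes every prime exponent by a multiple
  of \<open>k\<close>, and an allowed exponent is recovered from its residue mod
  \<open>k\<close>.\<close>

lemma reduced_full_unique:
  assumes N: "reduced_full k N" and M: "reduced_full k M" and ab: "a > 0" "b > 0"
    and eq: "a ^ k * N = b ^ k * M"
  shows "N = M"
proof (rule multiplicity_eq_nat)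
  fix p :: nat assume p: "prime p"
  have "multiplicity p (a ^ k * N) = k * multiplicity p a + multiplicity p N"
    using p N ab by (simp add: prime_elem_multiplicity_mult_distrib prime_elem_multiplicity_power_distrib reduced_full_def)
  moreover have "multiplicity p (b ^ k * M) = k * multiplicity p b + multiplicity p M"
    using p M ab by (simp add: prime_elem_multiplicity_mult_distrib prime_elem_multiplicity_power_distrib reduced_full_def)
  ultimately have "(k * multiplicity p a + multiplicity p N) mod k = (k * multiplicity p b + multiplicity p M) mod k"
    using eq by simp
  then have mod_eq: "multiplicity p N mod k = multiplicity p M mod k" by simp
  have *: "n mod k = n - k" if "k < n" "n < 2 * k" for n
    using that by (simp add: mod_if)
  show "multiplicity p N = multiplicity p M"
  proof -
    have "multiplicity p N = 0 \<or> k < multiplicity p N \<and> multiplicity p N < 2 * k"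
      "multiplicity p M = 0 \<or> k < multiplicity p M \<and> multiplicity p M < 2 * k"
      using N M p by (auto simp: reduced_full_def)
    then show ?thesis using mod_eq *[of "multiplicity p N"] *[of "multiplicity p M"] by auto
  qed
qed (use N M in \<open>auto simp: reduced_full_def\<close>)

text \<open>Squarefreeness lets a prime divide at most one \<open>b i\<close>, and only once, so its
  exponent in the product is 0 or \<open>k + i\<close>. The lower bound holds because each exponent
  is at least \<open>k + 1\<close> and the product of the \<open>b i\<close> is at least 2.\<close>

lemma Lambda_power:
  assumes l: "l \<in> Lambda k" and k: "k \<ge> 2"
  obtains N where "reduced_full k N" "l ^ k = real N" "N \<ge> 2 ^ (k + 1)"
proof -
  from l obtain b :: "nat \<Rightarrow> nat" where b: "\<forall>i\<in>{1..k-1}. b i \<ge> 1" "(\<Prod>i\<in>{1..k-1}. b i) \<ge> 2"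
      "squarefree (\<Prod>i\<in>{1..k-1}. b i)" and l_eq: "l = root k (real (\<Prod>i\<in>{1..k-1}. b i ^ (k + i)))"
    by (auto simp: Lambda_def)
  have bpos: "b i \<noteq> 0" if "Suc 0 \<le> i" "i \<le> k - Suc 0" for i
    using b(1)[rule_format, of i] that by auto
  define N where "N = (\<Prod>i\<in>{1..k-1}. b i ^ (k + i))"
  have "l ^ k = real N" using k unfolding l_eq N_def by (intro real_root_pow_pos2 of_nat_0_le_iff) simp
  moreover have "2 ^ (k + 1) \<le> N"
  proof -
    have "2 ^ (k + 1) \<le> (\<Prod>i\<in>{1..k-1}. b i) ^ (k + 1)" using b(2) by (rule power_mono) simp
    also have "\<dots> = (\<Prod>i\<in>{1..k-1}. b i ^ (k + 1))" by (rule prod_power_distrib)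
    also have "\<dots> \<le> N" unfolding N_def using b(1) by (intro prod_mono conjI power_increasing) auto
    finally show ?thesis .
  qed
  moreover have "reduced_full k N"
    unfolding reduced_full_def
  proof (intro conjI allI impI)
    show "N > 0" using b(1) by (auto simp: N_def intro!: prod_pos)
    fix p :: nat assume p: "prime p"
    have nz: "0 \<notin> b ` {1..k-1}" using b(1) by auto
    have "multiplicity p N = (\<Sum>i\<in>{1..k-1}. multiplicity p (b i ^ (k + i)))"
      unfolding N_def using p by (intro prime_elem_multiplicity_prod_distrib) (auto simp: bpos)
    also have "\<dots> = (\<Sum>i\<in>{1..k-1}. (k + i) * multiplicity p (b i))"
      using p by (intro sum.cong refl prime_elem_multiplicity_power_distrib) (auto simp: bpos)
    finally have vN: "multiplicity p N = (\<Sum>i\<in>{1..k-1}. (k + i) * multiplicity p (b i))" .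
    have "(\<Sum>i\<in>{1..k-1}. multiplicity p (b i)) = multiplicity p (\<Prod>i\<in>{1..k-1}. b i)"
      using p nz by (intro prime_elem_multiplicity_prod_distrib[symmetric]) auto
    also have "\<dots> \<le> 1" 
    proof -
      have "(\<Prod>i\<in>{1..k-1}. b i) \<noteq> 0" using b(2) by linarith
      then show ?thesis using squarefree_factorial_semiring'' b(3) p by blast
    qed
    finally have le1: "(\<Sum>i\<in>{1..k-1}. multiplicity p (b i)) \<le> 1" .
    show "multiplicity p N = 0 \<or> k < multiplicity p N \<and> multiplicity p N < 2 * k"
    proof (cases "\<exists>i\<in>{1..k-1}. multiplicity p (b i) > 0")
      case False
      then show ?thesis by (simp add: vN)
    next
      case True
      then obtain i where i: "i \<in> {1..k-1}" "multiplicity p (b i) > 0" by blast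
      have "(\<Sum>j\<in>{1..k-1}. multiplicity p (b j)) = multiplicity p (b i) + (\<Sum>j\<in>{1..k-1}-{i}. multiplicity p (b j))"
        using i by (intro sum.remove) auto
      then have 1: "multiplicity p (b i) = 1" "(\<Sum>j\<in>{1..k-1}-{i}. multiplicity p (b j)) = 0"
        using le1 i by linarith+
      have "multiplicity p N = (k + i) * multiplicity p (b i) + (\<Sum>j\<in>{1..k-1}-{i}. (k + j) * multiplicity p (b j))"
        unfolding vN using i by (intro sum.remove) auto
      also have "\<dots> = k + i" using 1 by simp
      finally show ?thesis using i by auto
    qed
  qed
  ultimately show thesis using that by blast
qed

text \<open>The second bound is \<open>2 powr (1 + 1 / k)\<close>. It keeps \<open>2 / l\<close>
  uniformly away from 1, as convergence of the infinite product to a positive limit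
  requires.\<close>

lemma Lambda_gt_2:
  assumes l: "l \<in> Lambda k" and k: "k \<ge> 2"
  shows "l > 2" "l \<ge> root k (2 ^ (k + 1))"
proof -
  obtain N where N: "l ^ k = real N" "N \<ge> 2 ^ (k + 1)" using Lambda_power[OF l k] by blast
  have l0: "l \<ge> 0" using l k by (auto simp: Lambda_def prod_nonneg)
  have "real (2 ^ (k + 1)) \<le> real N" using N(2) by (rule of_nat_mono)
  then have ge: "2 ^ (k + 1) \<le> l ^ k" using N by simp
  have "root k (2 ^ (k + 1)) \<le> root k (l ^ k)" using k ge by (simp del: power_Suc)
  then show "l \<ge> root k (2 ^ (k + 1))" using k l0 by (simp add: real_root_power_cancel)
  have "2 ^ k < (2::real) ^ (k + 1)" by simp
  then have "2 ^ k < l ^ k" using ge by linarith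
  then show "l > 2" using l0 by (rule power_less_imp_less_base)
qed

text \<open>Uniqueness of the decomposition of a \<open>k\<close>-full number. It yields both the
  irrationality of ratios and the injectivity in counting \<open>S_set\<close> elements.\<close>

lemma Lambda_multiples_eq:
  assumes l: "l \<in> Lambda k" and l': "l' \<in> Lambda k" and k: "k \<ge> 2" and "a > 0" "b > 0"
    and eq: "real a * l = real b * l'"
  shows "l = l'"
proof -
  obtain N where N: "reduced_full k N" "l ^ k = real N" using Lambda_power[OF l k] by blast
  obtain N' where N': "reduced_full k N'" "l' ^ k = real N'" using Lambda_power[OF l' k] by blast
  have "(real a * l) ^ k = (real b * l') ^ k" using eq by simp
  then have "real (a ^ k * N) = real (b ^ k * N')" by (simp add: power_mult_distrib N N')
  then have "a ^ k * N = b ^ k * N'" using of_nat_eq_iff by blast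
  then have "N = N'" using reduced_full_unique N N' assms by blast
  then have "l ^ k = l' ^ k" using N N' by simp
  moreover have "l > 2" "l' > 2" using Lambda_gt_2 l l' k by auto
  ultimately show ?thesis using k by (intro power_eq_imp_eq_base[of l k l']) auto
qed

lemma Lambda_ratio_irrational:
  assumes l: "l \<in> Lambda k" and l': "l' \<in> Lambda k" and k: "k \<ge> 2" and "l \<noteq> l'"
  shows "l / l' \<notin> \<rat>"
proof
  assume "l / l' \<in> \<rat>"
  then obtain m n where mn: "n \<noteq> 0" "\<bar>l / l'\<bar> = real m / real n" by (rule Rats_abs_nat_div_natE)
  have pos: "l > 2" "l' > 2" using Lambda_gt_2 l l' k by auto
  then have eq: "real n * l = real m * l'" using mn by (simp add: field_simps)
  moreover have "m > 0" using mn pos by (cases "m = 0") auto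
  ultimately show False using Lambda_multiples_eq[OF l l' k, of n m] mn assms by auto
qed

text \<open>The number 1 also satisfies \<open>reduced_full\<close>, so for a rational
  \<open>l\<close> uniqueness would force \<open>l ^ k = 1\<close>.\<close>

lemma Lambda_irrational:
  assumes l: "l \<in> Lambda k" and k: "k \<ge> 2"
  shows "l \<notin> \<rat>"
proof
  assume "l \<in> \<rat>"
  then obtain m n where mn: "n \<noteq> 0" "\<bar>l\<bar> = real m / real n" by (rule Rats_abs_nat_div_natE)
  obtain N where N: "reduced_full k N" "l ^ k = real N" "N \<ge> 2 ^ (k + 1)" using Lambda_power[OF l k] by blast
  have pos: "l > 2" using Lambda_gt_2 l k by auto
  then have "real n * l = real m" using mn by (simp add: field_simps)
  then have "(real n * l) ^ k = real m ^ k" by simp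
  then have "real (n ^ k * N) = real (m ^ k * 1)" by (simp add: power_mult_distrib N)
  then have "n ^ k * N = m ^ k * 1" using of_nat_eq_iff by blast
  moreover have "m > 0" using mn pos by (cases "m = 0") auto
  moreover have "reduced_full k 1" by (simp add: reduced_full_def)
  ultimately have "N = 1" using reduced_full_unique[OF N(1), of 1 n m] mn by auto
  then show False using N(3) one_less_power[of "2::nat" "k + 1"] by linarith
qed

text \<open>Multiplying the relation by \<open>j\<close> isolates \<open>m j\<close> as a rational
  combination of \<open>j\<close> and the ratios \<open>j / l\<close> with
  \<open>l \<noteq> j\<close>. All of these are irrational radicals, so the rational value
  \<open>m j\<close> vanishes.\<close>

theorem Lambda_inverses_independent:
  fixes m :: "real \<Rightarrow> int"
  assumes fin: "finite F" and F: "F \<subseteq> Lambda k" and k: "k \<ge> 2"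
    and int: "(\<Sum>l\<in>F. of_int (m l) * (1 / l)) \<in> \<int>" and j: "j \<in> F"
  shows "m j = 0"
proof -
  obtain M where M: "(\<Sum>l\<in>F. of_int (m l) * (1 / l)) = real_of_int M" using int by (auto elim: Ints_cases)
  \<comment> \<open>The index \<open>j\<close> itself is free for the integer term: it carries the
    radical \<open>j\<close> with coefficient \<open>M\<close>.\<close>
  define \<alpha> where "\<alpha> l = (if l = j then j else j / l)" for l
  define c where "c l = (if l = j then of_int M else - of_int (m l) :: rat)" for l
  have pos: "l > 2" if "l \<in> F" for l using Lambda_gt_2 that F k by auto
  have j0: "j \<noteq> 0" using pos[OF j] by simp
  have pow: "l ^ k \<in> \<rat>" if "l \<in> F" for l
  proof -
    from that F have "l \<in> Lambda k" by blast
    then obtain N where "l ^ k = real N" using Lambda_power[OF _ k] by blast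
    then show ?thesis by simp
  qed
  have "of_int (m j) = (0::rat)"
  proof (rule rational_combination_of_irrational_radicals[OF fin, of k \<alpha> c])
    show "\<alpha> i > 0" if "i \<in> F" for i using pos[OF that] pos[OF j] by (simp add: \<alpha>_def)
    show "\<alpha> i ^ k \<in> \<rat>" if "i \<in> F" for i using pow[OF that] pow[OF j] by (simp add: \<alpha>_def power_divide)
    show "\<alpha> i \<notin> \<rat>" if "i \<in> F" for i
      using Lambda_irrational[of j k] Lambda_ratio_irrational[of j k i] that j F k by (auto simp: \<alpha>_def)
    have "(\<Sum>i\<in>F. of_rat (c i) * \<alpha> i) = of_int M * j + (\<Sum>i\<in>F-{j}. of_rat (c i) * \<alpha> i)"
      using j fin by (subst sum.remove[of _ j]) (auto simp: c_def \<alpha>_def)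
    also have "(\<Sum>i\<in>F-{j}. of_rat (c i) * \<alpha> i) = - j * (\<Sum>i\<in>F-{j}. of_int (m i) * (1 / i))"
      unfolding sum_distrib_left by (intro sum.cong refl) (auto simp: c_def \<alpha>_def of_rat_minus)
    also have "(\<Sum>i\<in>F-{j}. of_int (m i) * (1 / i)) = of_int M - of_int (m j) / j"
      using M j fin by (subst (asm) sum.remove[of _ j]) auto
    finally show "(\<Sum>i\<in>F. of_rat (c i) * \<alpha> i) = of_rat (of_int (m j))"
      using j0 by (simp add: algebra_simps)
  qed (use k in simp)
  then show ?thesis by simp
qed

section \<open>Weyl equidistribution\<close>

definition has_mean :: "(nat \<Rightarrow> complex) \<Rightarrow> complex \<Rightarrow> bool" where
  "has_mean f L \<longleftrightarrow> (\<lambda>N. (\<Sum>n=1..N. f n) / of_nat N) \<longlonglongrightarrow> L"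

lemma has_mean_add: "has_mean f a \<Longrightarrow> has_mean g b \<Longrightarrow> has_mean (\<lambda>n. f n + g n) (a + b)"
  unfolding has_mean_def by (drule (1) tendsto_add) (simp add: sum.distrib add_divide_distrib)

lemma has_mean_cmult: "has_mean f a \<Longrightarrow> has_mean (\<lambda>n. c * f n) (c * a)"
  unfolding has_mean_def by (drule tendsto_mult_left[where c=c]) (simp add: sum_distrib_left)

lemma has_mean_const: "has_mean (\<lambda>n. c) c"
  unfolding has_mean_def
  by (rule tendsto_eventually, rule eventually_sequentiallyI[of 1]) simp

text \<open>For nonintegral \<open>x\<close> the geometric sums are bounded by
  \<open>2 / norm (1 - z)\<close> independently of \<open>N\<close>, so division by \<open>N\<close>
  sends them to 0.\<close>

lemma has_mean_cis:
  assumes "x \<notin> \<int>"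
  shows "has_mean (\<lambda>n. cis (2 * pi * (real n * x))) 0"
proof -
  define z where "z = cis (2 * pi * x)"
  have "z \<noteq> 1"
  proof
    assume "z = 1"
    then have "cos (2 * pi * x) = 1" by (simp add: z_def cis.ctr complex_eq_iff)
    then obtain n :: int where "2 * pi * x = of_int n * 2 * pi" by (auto simp: cos_one_2pi_int)
    then have "x = of_int n" by simp
    then show False using assms by simp
  qed
  have pow: "cis (2 * pi * (real n * x)) = z ^ n" for n
    by (simp only: z_def Complex.DeMoivre mult.commute mult.left_commute mult.assoc)
  have bound: "norm (\<Sum>n=1..N. z ^ n) \<le> 2 / norm (1 - z)" for N
  proof -
    have "norm (z ^ i) = 1" for i by (simp add: norm_power z_def)
    have "(\<Sum>n=1..N. z ^ n) = (if N < 1 then 0 else (z ^ 1 - z ^ Suc N) / (1 - z))"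
      using \<open>z \<noteq> 1\<close> by (simp add: sum_gp)
    moreover have "norm (z ^ 1 - z ^ Suc N) \<le> 2"
      using norm_triangle_ineq4[of "z ^ 1" "z ^ Suc N"] \<open>\<And>i. norm (z ^ i) = 1\<close> by (metis one_add_one)
    ultimately show ?thesis by (auto simp: norm_divide intro!: divide_right_mono)
  qed
  have "(\<lambda>N. 2 / norm (1 - z) / real N) \<longlonglongrightarrow> 0"
    by (rule lim_const_over_n)
  then show ?thesis unfolding has_mean_def pow
  proof (rule Lim_null_comparison[rotated], intro always_eventually allI)
    show "norm ((\<Sum>n=1..N. z ^ n) / of_nat N) \<le> 2 / norm (1 - z) / real N" for N
      unfolding norm_divide norm_of_nat by (intro divide_right_mono bound) simp
  qed
qed

text \<open>The second argument is the constant Fourier coefficient.\<close>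

inductive trig_poly :: "(real \<Rightarrow> complex) \<Rightarrow> complex \<Rightarrow> bool" where
  char: "trig_poly (\<lambda>x. cis (2 * pi * (of_int m * x))) (if m = 0 then 1 else 0)"
| add: "trig_poly f a \<Longrightarrow> trig_poly g b \<Longrightarrow> trig_poly (\<lambda>x. f x + g x) (a + b)"
| cmult: "trig_poly f a \<Longrightarrow> trig_poly (\<lambda>x. c * f x) (c * a)"

lemma trig_poly_const: "trig_poly (\<lambda>x. c) c"
  using trig_poly.cmult[OF trig_poly.char[of 0], of c] by simp

lemma trig_poly_mult_char:
  assumes "trig_poly f a"
  shows "\<exists>b. trig_poly (\<lambda>x. cis (2 * pi * (of_int m * x)) * f x) b"
  using assms
proof induction
  case (char m')
  have "cis (2 * pi * (of_int m * x)) * cis (2 * pi * (of_int m' * x)) = cis (2 * pi * (of_int (m + m') * x))" for x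
    by (simp add: cis_mult algebra_simps)
  then show ?case using trig_poly.char[of "m + m'"] by auto
next
  case (add f a g b)
  then show ?case by (auto simp: algebra_simps dest: trig_poly.add)
next
  case (cmult f a c)
  then show ?case by (auto simp: mult.left_commute dest: trig_poly.cmult)
qed

text \<open>Only the existence of a constant coefficient is asserted; where its size matters it is
  estimated as an integral over a period.\<close>

lemma trig_poly_mult:
  assumes "trig_poly f a" "trig_poly g b"
  shows "\<exists>c. trig_poly (\<lambda>x. f x * g x) c"
  using assms(1)
proof induction
  case (char m)
  then show ?case using trig_poly_mult_char[OF assms(2)] by blast
next
  case (add f a g b)
  then show ?case by (auto simp: algebra_simps dest: trig_poly.add)
next
  case (cmult f a c)
  then show ?case by (auto simp: mult.assoc dest: trig_poly.cmult)
qed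

text \<open>A nontrivial character has a primitive of period 1. The starting point \<open>c\<close>
  is arbitrary so that an arc passing through 0 can be treated as an ordinary interval.\<close>

lemma trig_poly_has_integral:
  assumes "trig_poly f a"
  shows "(f has_integral a) {c..c + 1}"
  using assms
proof induction
  case (char m)
  show ?case
  proof (cases "m = 0")
    case True
    then show ?thesis using has_integral_const_real[of "1::complex" c "c + 1"] by simp
  next
    case False
    define F where "F x = cis (2 * pi * (of_int m * x)) / (\<i> * (2 * pi * of_int m))" for x
    have "((\<lambda>x. cis (2 * pi * (of_int m * x))) has_integral (F (c + 1) - F c)) {c..c + 1}"
    proof (rule fundamental_theorem_of_calculus)
      fix x :: real
      have "(F has_vector_derivative (cis (2 * pi * (of_int m * x)))) (at x)"
        unfolding F_def using False
        by (auto intro!: derivative_eq_intros has_vector_derivative_real_field simp: cis_conv_exp)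
      then show "(F has_vector_derivative (cis (2 * pi * (of_int m * x)))) (at x within {c..c + 1})"
        by (rule has_vector_derivative_at_within)
    qed simp
    moreover have "F (c + 1) = F c"
    proof -
      have "cis (2 * pi * (of_int m * (c + 1))) = cis (2 * pi * (of_int m * c)) * cis (2 * pi * of_int m)"
        by (simp add: cis_mult algebra_simps)
      moreover have "cis (2 * pi * of_int m) = 1"
        by (simp add: cis_multiple_2pi)
      ultimately show ?thesis by (simp add: F_def)
    qed
    ultimately show ?thesis using False by simp
  qed
next
  case (add f a g b)
  then show ?case by (intro has_integral_add)
next
  case (cmult f a c)
  then show ?case by (intro has_integral_mult_right)
qed

lemma trig_poly_of_real_polynomial_function:
  fixes p :: "complex \<Rightarrow> real"
  assumes "real_polynomial_function p"
  shows "\<exists>a. trig_poly (\<lambda>x. of_real (p (cis (2 * pi * x)))) a"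
  using assms
proof (induction rule: real_polynomial_function.induct)
  case (linear f)
  have f: "f z = Re z * f 1 + Im z * f \<i>" for z
  proof -
    have "z = Re z *\<^sub>R 1 + Im z *\<^sub>R \<i>" by (simp add: complex_eq_iff)
    then have "f z = f (Re z *\<^sub>R 1 + Im z *\<^sub>R \<i>)" by simp
    then show ?thesis
      using linear by (simp add: linear_add linear_scale bounded_linear.linear)
  qed
  \<comment> \<open>The coefficients come from writing cosine and sine as combinations of the
    characters of frequency 1 and -1.\<close>
  define c1 c2 where "c1 = complex_of_real (f 1) / 2 - \<i> * f \<i> / 2"
    and "c2 = complex_of_real (f 1) / 2 + \<i> * f \<i> / 2"
  have eq: "complex_of_real (f (cis (2 * pi * x))) =
      c1 * cis (2 * pi * (of_int 1 * x)) + c2 * cis (2 * pi * (of_int (- 1) * x))" for x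
    by (subst f) (simp add: c1_def c2_def complex_eq_iff algebra_simps)
  show ?case
    unfolding eq by (rule exI, rule trig_poly.add; rule trig_poly.cmult, rule trig_poly.char)
next
  case (const c)
  then show ?case using trig_poly_const by blast
next
  case (add f g)
  then show ?case by (auto dest: trig_poly.add)
next
  case (mult f g)
  then show ?case by (auto dest: trig_poly_mult)
qed

section \<open>Approximation of arcs by trigonometric polynomials\<close>

lemma cis_eq_imp_diff_int:
  assumes "cis (2 * pi * x) = cis (2 * pi * y)"
  shows "x - y \<in> \<int>"
proof -
  have "cis (2 * pi * (x - y)) = 1"
    using assms by (simp add: right_diff_distrib flip: cis_divide)
  then have "cos (2 * pi * (x - y)) = 1" by (simp add: complex_eq_iff)
  then obtain n :: int where "2 * pi * (x - y) = of_int n * 2 * pi" by (auto simp: cos_one_2pi_int)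
  then have "x - y = of_int n" by simp
  then show ?thesis by simp
qed

lemma cis_2pi_frac: "cis (2 * pi * frac x) = cis (2 * pi * x)"
proof -
  have "cis (2 * pi * x) = cis (2 * pi * frac x) * cis (2 * pi * of_int \<lfloor>x\<rfloor>)"
    by (simp add: cis_mult frac_def algebra_simps)
  also have "cis (2 * pi * of_int \<lfloor>x\<rfloor>) = 1" by (simp add: cis_multiple_2pi)
  finally show ?thesis by simp
qed

text \<open>The two intervals map to disjoint compact sets on the unit circle. A Urysohn function
  separates them, and Stone-Weierstrass replaces it on the circle by a real polynomial up to
  \<open>\<delta>\<close>; composed with \<open>cis\<close> this is a trigonometric
  polynomial.\<close>

lemma arc_bump_trig_poly:
  fixes l u \<delta> :: real
  assumes \<delta>: "\<delta> > 0"
  obtains p a where "trig_poly (\<lambda>x. complex_of_real (p x)) a" "\<And>x. p (frac x) = p x"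
    "\<And>x. - \<delta> \<le> p x" "\<And>x. p x \<le> 1 + \<delta>"
    "\<And>x. x \<in> {l..u} \<Longrightarrow> 1 - \<delta> \<le> p x" "\<And>x. x \<in> {u + \<delta>..l + 1 - \<delta>} \<Longrightarrow> p x \<le> \<delta>"
proof -
  let ?e = "\<lambda>x. cis (2 * pi * x)"
  define S where "S = ?e ` {l..u}"
  define T where "T = ?e ` {u + \<delta>..l + 1 - \<delta>}"
  have cont: "continuous_on X ?e" for X by (intro continuous_intros)
  have "closed S" "closed T" unfolding S_def T_def
    by (intro compact_imp_closed compact_continuous_image cont compact_Icc)+
  moreover have "S \<inter> T = {}"
  proof (rule ccontr)
    assume "S \<inter> T \<noteq> {}"
    then obtain x y where xy: "x \<in> {l..u}" "y \<in> {u + \<delta>..l + 1 - \<delta>}" "?e x = ?e y"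
      unfolding S_def T_def by blast
    then have "y - x \<in> \<int>" using cis_eq_imp_diff_int[of y x] by simp
    then obtain n :: int where n: "y - x = of_int n" by (auto elim: Ints_cases)
    have "0 < y - x" "y - x < 1" using xy \<delta> by auto
    then show False unfolding n by simp
  qed
  ultimately obtain f :: "complex \<Rightarrow> real" where f: "continuous_on UNIV f" "\<And>x. f x \<in> closed_segment 1 0"
      "\<And>x. f x = 1 \<longleftrightarrow> x \<in> S" "\<And>x. f x = 0 \<longleftrightarrow> x \<in> T"
    using Urysohn_strong[of S T "1::real" 0] by (metis zero_neq_one)
  have f01: "0 \<le> f z" "f z \<le> 1" for z using f(2)[of z] by (auto simp: closed_segment_eq_real_ivl)
  obtain g where g: "real_polynomial_function g" "\<And>x. x \<in> sphere 0 1 \<Longrightarrow> \<bar>f x - g x\<bar> < \<delta>"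
    using Stone_Weierstrass_real_polynomial_function[of "sphere (0::complex) 1" f \<delta>] \<delta> f(1)
    by (metis compact_sphere continuous_on_subset top_greatest)
  obtain a where a: "trig_poly (\<lambda>x. of_real (g (?e x))) a"
    using trig_poly_of_real_polynomial_function[OF g(1)] by blast
  have near: "\<bar>f (?e x) - g (?e x)\<bar> < \<delta>" for x by (rule g(2)) simp
  show thesis
  proof (rule that[OF a])
    fix x
    show "g (?e (frac x)) = g (?e x)" by (simp add: cis_2pi_frac)
    show "- \<delta> \<le> g (?e x)" "g (?e x) \<le> 1 + \<delta>" using near[of x] f01[of "?e x"] by linarith+
    show "1 - \<delta> \<le> g (?e x)" if "x \<in> {l..u}"
    proof -
      have "f (?e x) = 1" using that f(3) by (auto simp: S_def)
      then show ?thesis using near[of x] by linarith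
    qed
    show "g (?e x) \<le> \<delta>" if "x \<in> {u + \<delta>..l + 1 - \<delta>}"
    proof -
      have "f (?e x) = 0" using that f(4) by (auto simp: T_def)
      then show ?thesis using near[of x] by linarith
    qed
  qed
qed

lemma trig_poly_real_has_integral:
  assumes "trig_poly (\<lambda>x. complex_of_real (p x)) a"
  obtains b where "a = complex_of_real b" "\<And>c. (p has_integral b) {c..c + 1}"
proof -
  have I: "((\<lambda>x. complex_of_real (p x)) has_integral a) {c..c + 1}" for c
    by (rule trig_poly_has_integral[OF assms])
  have Re: "(p has_integral Re a) {c..c + 1}" for c
    using has_integral_Re[OF I] by simp
  have "((\<lambda>x. complex_of_real (p x)) has_integral complex_of_real (Re a)) {0..0 + 1}"
    by (rule has_integral_of_real[OF Re])
  then have "a = complex_of_real (Re a)" using I[of 0] has_integral_unique by blast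
  then show thesis using that Re by blast
qed

lemma has_integral_indicator_subinterval:
  fixes a b c d :: real
  assumes "a \<le> c" "c \<le> d" "d \<le> b"
  shows "((\<lambda>x. if x \<in> {c..d} then 1 else 0) has_integral (d - c)) {a..b}"
  using has_integral_restrict_closed_subinterval[of "\<lambda>x. 1::real" "d - c" c d a b]
    has_integral_const_real[of "1::real" c d] assms by (simp add: cbox_interval)

text \<open>\<open>p\<close> is a bump for the arc shrunk by \<open>\<delta>\<close> and
  \<open>q\<close> one for the arc with a margin \<open>\<delta>\<close> outside. The indicator lies
  between them up to small errors, so \<open>q - p\<close> plus a constant dominates the error
  pointwise and has small mean.\<close>

lemma interval_trig_approx:
  fixes l u \<epsilon> :: real
  assumes lu: "0 \<le> l" "l \<le> u" "u \<le> 1" and A: "{l<..<u} \<subseteq> A" "A \<subseteq> {l..u}" and \<epsilon>: "\<epsilon> > 0"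
  obtains g h :: "real \<Rightarrow> real" and a b :: complex
  where "trig_poly (\<lambda>x. complex_of_real (g x)) a" "trig_poly (\<lambda>x. complex_of_real (h x)) b"
    "\<And>x. \<bar>(if frac x \<in> A then 1 else 0) - g x\<bar> \<le> h x"
    "norm (a - complex_of_real (u - l)) \<le> \<epsilon>" "norm b \<le> \<epsilon>"
proof -
  \<comment> \<open>The bounds below give \<open>b' - a' \<le> 6 * \<delta>\<close>, and
    \<open>h\<close> adds \<open>3 * \<delta>\<close>, hence the ninth.\<close>
  define \<delta> where "\<delta> = \<epsilon> / 9"
  have \<delta>: "\<delta> > 0" using \<epsilon> by (simp add: \<delta>_def)
  obtain p a where p: "trig_poly (\<lambda>x. complex_of_real (p x)) a" "\<And>x. p (frac x) = p x"
    "\<And>x. - \<delta> \<le> p x" "\<And>x. p x \<le> 1 + \<delta>"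
    "\<And>x. x \<in> {l + \<delta>..u - \<delta>} \<Longrightarrow> 1 - \<delta> \<le> p x" "\<And>x. x \<in> {u - \<delta> + \<delta>..l + \<delta> + 1 - \<delta>} \<Longrightarrow> p x \<le> \<delta>"
    using arc_bump_trig_poly[OF \<delta>, where l="l + \<delta>" and u="u - \<delta>"] by blast
  obtain q b where q: "trig_poly (\<lambda>x. complex_of_real (q x)) b" "\<And>x. q (frac x) = q x"
    "\<And>x. - \<delta> \<le> q x" "\<And>x. q x \<le> 1 + \<delta>"
    "\<And>x. x \<in> {l..u} \<Longrightarrow> 1 - \<delta> \<le> q x" "\<And>x. x \<in> {u + \<delta>..l + 1 - \<delta>} \<Longrightarrow> q x \<le> \<delta>"
    using arc_bump_trig_poly[OF \<delta>, where l=l and u=u] by blast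
  obtain a' where a': "a = complex_of_real a'" "\<And>c. (p has_integral a') {c..c + 1}"
    using trig_poly_real_has_integral[OF p(1)] by blast
  obtain b' where b': "b = complex_of_real b'" "\<And>c. (q has_integral b') {c..c + 1}"
    using trig_poly_real_has_integral[OF q(1)] by blast
  define h where "h x = q x + (- 1) * p x + 3 * \<delta>" for x
  have "trig_poly (\<lambda>x. complex_of_real (q x) + (- 1) * complex_of_real (p x) + complex_of_real (3 * \<delta>))
      (b + (- 1) * a + complex_of_real (3 * \<delta>))"
    by (intro trig_poly.add trig_poly.cmult p q trig_poly_const)
  then have h: "trig_poly (\<lambda>x. complex_of_real (h x)) (complex_of_real (b' - a' + 3 * \<delta>))"
    by (simp add: h_def a' b')
  have approx: "\<bar>(if frac x \<in> A then 1 else 0) - p x\<bar> \<le> h x" for x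
  proof (cases "frac x \<in> A")
    case True
    then have "1 - \<delta> \<le> q (frac x)" using A by (intro q) auto
    then have "1 - \<delta> \<le> q x" using q(2) by simp
    then show ?thesis using True p(4)[of x] \<delta> by (simp add: h_def abs_le_iff)
  next
    case False
    then have "frac x \<le> l \<or> u \<le> frac x" using A(1) by (meson greaterThanLessThan_iff not_le subsetD)
    then have "p x \<le> \<delta>"
    proof
      assume "frac x \<le> l"
      \<comment> \<open>A point left of the arc is moved one period to the right, into the interval
        on which \<open>p\<close> is known to be small.\<close>
      then have "frac x + 1 \<in> {u - \<delta> + \<delta>..l + \<delta> + 1 - \<delta>}"
        unfolding atLeastAtMost_iff using lu frac_ge_0[of x] by (intro conjI; linarith)
      then have "p (frac x + 1) \<le> \<delta>" by (rule p)
      moreover have "p (frac x + 1) = p x"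
        using p(2)[of "frac x + 1"] p(2)[of x] by (simp add: frac_1_eq frac_frac)
      ultimately show ?thesis by simp
    next
      assume "u \<le> frac x"
      then have "frac x \<in> {u - \<delta> + \<delta>..l + \<delta> + 1 - \<delta>}"
        unfolding atLeastAtMost_iff using lu frac_lt_1[of x] by (intro conjI; linarith)
      then have "p (frac x) \<le> \<delta>" by (rule p)
      then show ?thesis using p(2) by simp
    qed
    then show ?thesis using False p(3)[of x] q(3)[of x] by (simp add: h_def)
  qed
  \<comment> \<open>The shrunk arc may be empty; then \<open>u - l < 2 * \<delta>\<close> and the
    trivial bound \<open>- \<delta> \<le> p\<close> suffices.\<close>
  have lower: "u - l - 3 * \<delta> \<le> a'"
  proof (cases "l + \<delta> \<le> u - \<delta>")
    case True
    have "((\<lambda>x. (if x \<in> {l + \<delta>..u - \<delta>} then 1 else 0) + (- \<delta>)) has_integral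
        (u - \<delta> - (l + \<delta>) + (- \<delta>))) {l..l + 1}"
      using has_integral_const_real[of "- \<delta>" l "l + 1"] True \<delta> lu
      by (intro has_integral_add has_integral_indicator_subinterval) auto
    moreover have "(if x \<in> {l + \<delta>..u - \<delta>} then 1 else 0) + (- \<delta>) \<le> p x" for x
      using p(3)[of x] p(5)[of x] by (cases "x \<in> {l + \<delta>..u - \<delta>}") simp_all
    ultimately have "u - \<delta> - (l + \<delta>) + (- \<delta>) \<le> a'"
      using has_integral_le[OF _ a'(2)[of l]] by blast
    then show ?thesis by simp
  next
    case False
    have "((\<lambda>x. - \<delta>) has_integral - \<delta>) {l..l + 1}"
      using has_integral_const_real[of "- \<delta>" l "l + 1"] by simp
    then have "- \<delta> \<le> a'" using has_integral_le[OF _ a'(2)[of l]] p(3) by blast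
    then show ?thesis using False by linarith
  qed
  have upper: "b' \<le> u - l + 3 * \<delta>"
  proof (cases "u + \<delta> \<le> l + 1 - \<delta>")
    case True
    have "((\<lambda>x. (1 + \<delta>) - (if x \<in> {u + \<delta>..l + 1 - \<delta>} then 1 else 0)) has_integral
        ((1 + \<delta>) - (l + 1 - \<delta> - (u + \<delta>)))) {l..l + 1}"
      using has_integral_const_real[of "1 + \<delta>" l "l + 1"] True \<delta> lu
      by (intro has_integral_diff has_integral_indicator_subinterval) auto
    moreover have "q x \<le> (1 + \<delta>) - (if x \<in> {u + \<delta>..l + 1 - \<delta>} then 1 else 0)" for x
      using q(4)[of x] q(6)[of x] by (cases "x \<in> {u + \<delta>..l + 1 - \<delta>}") simp_all
    ultimately have "b' \<le> (1 + \<delta>) - (l + 1 - \<delta> - (u + \<delta>))"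
      using has_integral_le[OF b'(2)[of l]] by blast
    then show ?thesis by simp
  next
    case False
    have "((\<lambda>x. 1 + \<delta>) has_integral 1 + \<delta>) {l..l + 1}"
      using has_integral_const_real[of "1 + \<delta>" l "l + 1"] by simp
    then have "b' \<le> 1 + \<delta>" using has_integral_le[OF b'(2)[of l]] q(4) by blast
    then show ?thesis using False by linarith
  qed
  \<comment> \<open>Nonnegativity of the mean of \<open>h\<close> supplies the upper bound for
    \<open>a'\<close>, since \<open>b'\<close> is already bounded above.\<close>
  have h0: "0 \<le> b' - a' + 3 * \<delta>"
  proof -
    have "(h has_integral (b' + (- 1) * a' + 3 * \<delta>)) {0..0 + 1}"
      unfolding h_def using has_integral_const_real[of \<delta> 0 1]
      by (intro has_integral_add has_integral_mult_right a' b') auto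
    then have "0 \<le> b' + (- 1) * a' + 3 * \<delta>"
      by (rule has_integral_nonneg) (use approx in \<open>smt (verit)\<close>)
    then show ?thesis by simp
  qed
  show thesis
  proof (rule that[OF p(1) h approx])
    have "\<bar>a' - (u - l)\<bar> \<le> \<epsilon>" using lower upper h0 \<delta> unfolding \<delta>_def by linarith
    then show "norm (a - complex_of_real (u - l)) \<le> \<epsilon>"
      unfolding a' by (metis norm_of_real of_real_diff)
    show "norm (complex_of_real (b' - a' + 3 * \<delta>)) \<le> \<epsilon>"
      unfolding norm_of_real using lower upper h0 \<delta> unfolding \<delta>_def by linarith
  qed
qed

section \<open>Weyl's criterion with weights, and equidistribution in boxes\<close>

lemma has_mean_trig_poly:
  assumes w: "\<And>m::int. has_mean (\<lambda>n. w n * cis (2 * pi * (of_int m * x n))) (if m = 0 then L else 0)"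
    and f: "trig_poly f a"
  shows "has_mean (\<lambda>n. w n * f (x n)) (L * a)"
  using f
proof induction
  case (char m)
  then show ?case using w[of m] by (auto split: if_splits)
next
  case (add f a g b)
  then show ?case using has_mean_add[OF add.IH] by (simp add: algebra_simps)
next
  case (cmult f a c)
  then show ?case using has_mean_cmult[OF cmult.IH, of c] by (simp add: algebra_simps)
qed

text \<open>Weyl's criterion in one coordinate. The bounded weight \<open>w\<close> holds the
  factors of the other coordinates, which allows coordinates to be treated one at a time. The proof
  sandwiches the indicator using \<open>interval_trig_approx\<close>.\<close>

lemma weighted_equidistribution:
  fixes x :: "nat \<Rightarrow> real" and w :: "nat \<Rightarrow> complex"
  assumes lu: "0 \<le> l" "l \<le> u" "u \<le> 1" and A: "{l<..<u} \<subseteq> A" "A \<subseteq> {l..u}"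
    and w1: "\<And>n. norm (w n) \<le> 1"
    and w: "\<And>m::int. has_mean (\<lambda>n. w n * cis (2 * pi * (of_int m * x n))) (if m = 0 then L else 0)"
    and x: "\<And>m::int. has_mean (\<lambda>n. cis (2 * pi * (of_int m * x n))) (if m = 0 then 1 else 0)"
  shows "has_mean (\<lambda>n. w n * (if frac (x n) \<in> A then 1 else 0)) (L * complex_of_real (u - l))"
  unfolding has_mean_def
proof (rule LIMSEQ_I)
  fix r :: real assume r: "r > 0"
  \<comment> \<open>Replacing the indicator by \<open>g\<close> costs at most
    \<open>2 * \<epsilon>\<close>, convergence of the mean costs \<open>\<epsilon>\<close>, and
    replacing \<open>a\<close> by the arc length costs \<open>norm L * \<epsilon>\<close>.\<close>
  define \<epsilon> where "\<epsilon> = r / (4 + norm L)"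
  have den: "4 + norm L > 0" by (smt (verit) norm_ge_zero)
  then have \<epsilon>: "\<epsilon> > 0" using r by (simp add: \<epsilon>_def)
  define ind where "ind n = (if frac (x n) \<in> A then 1 else 0 :: real)" for n
  obtain g h :: "real \<Rightarrow> real" and a b :: complex
    where gh: "trig_poly (\<lambda>x. complex_of_real (g x)) a" "trig_poly (\<lambda>x. complex_of_real (h x)) b"
      "\<And>x. \<bar>(if frac x \<in> A then 1 else 0) - g x\<bar> \<le> h x"
      "norm (a - complex_of_real (u - l)) \<le> \<epsilon>" "norm b \<le> \<epsilon>"
    using interval_trig_approx[OF lu A \<epsilon>] by metis
  have "has_mean (\<lambda>n. w n * complex_of_real (g (x n))) (L * a)"
    by (rule has_mean_trig_poly[OF w gh(1)])
  then obtain N1 where N1: "\<And>N. N \<ge> N1 \<Longrightarrow>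
      norm ((\<Sum>n=1..N. w n * complex_of_real (g (x n))) / of_nat N - L * a) < \<epsilon>"
    unfolding has_mean_def using LIMSEQ_D[OF _ \<epsilon>] by blast
  have "has_mean (\<lambda>n. 1 * complex_of_real (h (x n))) (1 * b)"
    by (rule has_mean_trig_poly[OF _ gh(2)]) (use x in simp)
  then obtain N2 where N2: "\<And>N. N \<ge> N2 \<Longrightarrow>
      norm ((\<Sum>n=1..N. complex_of_real (h (x n))) / of_nat N - b) < \<epsilon>"
    unfolding has_mean_def mult_1 using LIMSEQ_D[OF _ \<epsilon>] by blast
  show "\<exists>no. \<forall>N\<ge>no. norm ((\<Sum>n=1..N. w n * (if frac (x n) \<in> A then 1 else 0)) / of_nat N
      - L * complex_of_real (u - l)) < r"
  proof (intro exI allI impI)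
    fix N assume N: "N \<ge> max N1 N2"
    define X where "X = (\<Sum>n=1..N. w n * (if frac (x n) \<in> A then 1 else 0)) / complex_of_nat N"
    define Y where "Y = (\<Sum>n=1..N. w n * complex_of_real (g (x n))) / complex_of_nat N"
    have "X - Y = (\<Sum>n=1..N. w n * complex_of_real (ind n - g (x n))) / complex_of_nat N"
      unfolding X_def Y_def diff_divide_distrib[symmetric] sum_subtractf[symmetric]
      by (intro arg_cong2[where f="(/)"] sum.cong refl) (auto simp: ind_def algebra_simps)
    then have "norm (X - Y) = norm (\<Sum>n=1..N. w n * complex_of_real (ind n - g (x n))) / real N"
      by (simp add: norm_divide)
    also have "\<dots> \<le> (\<Sum>n=1..N. h (x n)) / real N"
    proof (intro divide_right_mono sum_norm_le)
      fix n
      have "norm (w n * complex_of_real (ind n - g (x n))) \<le> 1 * \<bar>ind n - g (x n)\<bar>"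
        unfolding norm_mult norm_of_real by (intro mult_right_mono w1) simp
      also have "\<dots> \<le> h (x n)" using gh(3)[of "x n"] by (simp add: ind_def)
      finally show "norm (w n * complex_of_real (ind n - g (x n))) \<le> h (x n)" .
    qed simp
    also have "\<dots> \<le> norm (complex_of_real ((\<Sum>n=1..N. h (x n)) / real N))"
      by (metis abs_ge_self norm_of_real)
    also have "complex_of_real ((\<Sum>n=1..N. h (x n)) / real N) = (\<Sum>n=1..N. complex_of_real (h (x n))) / of_nat N"
      by simp
    also have "norm \<dots> \<le> \<epsilon> + norm b"
      using N2[of N] N norm_triangle_sub[of "(\<Sum>n=1..N. complex_of_real (h (x n))) / of_nat N" b] by simp
    finally have XY: "norm (X - Y) \<le> 2 * \<epsilon>" using gh(5) by simp
    have YL: "norm (Y - L * a) < \<epsilon>" using N1[of N] N by (simp add: Y_def)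
    have La: "norm (L * a - L * complex_of_real (u - l)) \<le> norm L * \<epsilon>"
      using gh(4) by (simp add: norm_mult mult_left_mono flip: right_diff_distrib)
    have "norm (X - L * complex_of_real (u - l)) \<le> norm (X - Y) + norm (Y - L * a) + norm (L * a - L * complex_of_real (u - l))"
      using dist_triangle[of X "L * a" Y] dist_triangle[of X "L * complex_of_real (u - l)" "L * a"]
      unfolding dist_norm by linarith
    also have "\<dots> < 3 * \<epsilon> + norm L * \<epsilon>" using XY YL La by linarith
    also have "\<dots> \<le> (4 + norm L) * \<epsilon>" using \<epsilon> by (simp add: algebra_simps)
    also have "\<dots> = r" using den by (simp add: \<epsilon>_def)
    finally show "norm ((\<Sum>n=1..N. w n * (if frac (x n) \<in> A then 1 else 0)) / of_nat N
      - L * complex_of_real (u - l)) < r" by (simp add: X_def)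
  qed
qed

text \<open>For finite \<open>H\<close>, after clearing denominators, this is linear independence
  over the rationals of 1 together with the family \<open>\<theta>\<close>.\<close>

definition independent_mod_1 :: "'i set \<Rightarrow> ('i \<Rightarrow> real) \<Rightarrow> bool" where
  "independent_mod_1 H \<theta> \<longleftrightarrow>
     (\<forall>m :: 'i \<Rightarrow> int. (\<Sum>i\<in>H. of_int (m i) * \<theta> i) \<in> \<int> \<longrightarrow> (\<forall>i\<in>H. m i = 0))"

lemma has_mean_character:
  fixes \<theta> :: "'i \<Rightarrow> real" and m :: "'i \<Rightarrow> int"
  assumes H: "finite H" and indep: "independent_mod_1 H \<theta>"
    and G: "G \<subseteq> H"
  shows "has_mean (\<lambda>n. cis (2 * pi * (real n * (\<Sum>i\<in>G. of_int (m i) * \<theta> i)))) (if \<forall>i\<in>G. m i = 0 then 1 else 0)"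
proof (cases "\<forall>i\<in>G. m i = 0")
  case True
  then show ?thesis using has_mean_const[of 1] by simp
next
  case False
  have "(\<Sum>i\<in>G. of_int (m i) * \<theta> i) \<notin> \<int>"
  proof
    assume *: "(\<Sum>i\<in>G. of_int (m i) * \<theta> i) \<in> \<int>"
    define m' where "m' i = (if i \<in> G then m i else 0)" for i
    have "(\<Sum>i\<in>G. of_int (m i) * \<theta> i) = (\<Sum>i\<in>H. of_int (m' i) * \<theta> i)"
      using G H by (intro sum.mono_neutral_cong_left) (auto simp: m'_def)
    with * have "(\<Sum>i\<in>H. of_int (m' i) * \<theta> i) \<in> \<int>" by (simp only: )
    then have "\<forall>i\<in>H. m' i = 0" using indep unfolding independent_mod_1_def by blast
    then show False using False G unfolding m'_def by (metis subsetD)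
  qed
  then show ?thesis using False has_mean_cis by (simp only: if_False)
qed

text \<open>Mixed form for the induction: coordinates in \<open>F\<close> carry indicators, those in
  \<open>G\<close> characters. Converting coordinate \<open>i\<close> to an indicator needs the
  means with every character in \<open>i\<close>, which is the induction hypothesis for
  \<open>G\<close> enlarged by \<open>i\<close>; hence \<open>G\<close> and \<open>m\<close> are
  arbitrary.\<close>

lemma has_mean_box:
  fixes \<theta> :: "'i \<Rightarrow> real" and m :: "'i \<Rightarrow> int"
  assumes H: "finite H" and indep: "independent_mod_1 H \<theta>"
    and box: "\<forall>i\<in>H. 0 \<le> l i \<and> l i \<le> u i \<and> u i \<le> 1 \<and> {l i<..<u i} \<subseteq> A i \<and> A i \<subseteq> {l i..u i}"
    and F: "F \<subseteq> H" and G: "G \<subseteq> H" "F \<inter> G = {}"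
  shows "has_mean (\<lambda>n. (\<Prod>i\<in>F. if frac (real n * \<theta> i) \<in> A i then 1 else 0) *
      cis (2 * pi * (real n * (\<Sum>i\<in>G. of_int (m i) * \<theta> i))))
      (if \<forall>i\<in>G. m i = 0 then complex_of_real (\<Prod>i\<in>F. u i - l i) else 0)"
  using finite_subset[OF F H] F G
proof (induction F arbitrary: G m rule: finite_induct)
  case empty
  then show ?case using has_mean_character[OF H indep, of G m] by (simp only: prod.empty mult_1 of_real_1)
next
  case (insert i F)
  define w where "w n = (\<Prod>i\<in>F. if frac (real n * \<theta> i) \<in> A i then 1 else 0) *
      cis (2 * pi * (real n * (\<Sum>i\<in>G. of_int (m i) * \<theta> i)))" for n
  define L where "L = (if \<forall>i\<in>G. m i = 0 then complex_of_real (\<Prod>i\<in>F. u i - l i) else 0)"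
  have iH: "i \<in> H" "F \<subseteq> H" "i \<notin> G" "finite G"
    using insert.prems H by (auto intro: finite_subset)
  have w1: "norm (w n) \<le> 1" for n
    by (auto simp: w_def norm_mult prod_norm[symmetric] intro!: prod_le_1)
  have w: "has_mean (\<lambda>n. w n * cis (2 * pi * (of_int k * (real n * \<theta> i)))) (if k = 0 then L else 0)" for k :: int
  proof -
    have sums: "(\<Sum>j\<in>insert i G. of_int ((m(i := k)) j) * \<theta> j) = of_int k * \<theta> i + (\<Sum>j\<in>G. of_int (m j) * \<theta> j)"
      using iH by (simp, intro sum.cong) auto
    have "has_mean (\<lambda>n. (\<Prod>i\<in>F. if frac (real n * \<theta> i) \<in> A i then 1 else 0) *
        cis (2 * pi * (real n * (\<Sum>j\<in>insert i G. of_int ((m(i := k)) j) * \<theta> j))))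
        (if \<forall>j\<in>insert i G. (m(i := k)) j = 0 then complex_of_real (\<Prod>i\<in>F. u i - l i) else 0)"
      using insert.prems insert.hyps by (intro insert.IH) auto
    moreover have "(if \<forall>j\<in>insert i G. (m(i := k)) j = 0 then complex_of_real (\<Prod>i\<in>F. u i - l i) else 0)
        = (if k = 0 then L else 0)"
      using iH by (auto simp: L_def)
    moreover have "(\<Prod>i\<in>F. if frac (real n * \<theta> i) \<in> A i then 1 else 0) *
        cis (2 * pi * (real n * (\<Sum>j\<in>insert i G. of_int ((m(i := k)) j) * \<theta> j)))
        = w n * cis (2 * pi * (of_int k * (real n * \<theta> i)))" for n
      unfolding sums w_def mult.assoc cis_mult by (simp add: algebra_simps)
    ultimately show ?thesis by simp
  qed
  have x: "has_mean (\<lambda>n. cis (2 * pi * (of_int k * (real n * \<theta> i)))) (if k = 0 then 1 else 0)" for k :: int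
    using has_mean_character[OF H indep, of "{i}" "\<lambda>_. k"] iH by (simp add: mult.left_commute)
  have "has_mean (\<lambda>n. w n * (if frac (real n * \<theta> i) \<in> A i then 1 else 0)) (L * complex_of_real (u i - l i))"
    using box[rule_format, OF iH(1)] by (intro weighted_equidistribution w1 w x) auto
  moreover have "L * complex_of_real (u i - l i) =
      (if \<forall>i\<in>G. m i = 0 then complex_of_real (\<Prod>i\<in>insert i F. u i - l i) else 0)"
    using insert.hyps by (simp add: L_def mult.commute)
  moreover have "w n * (if frac (real n * \<theta> i) \<in> A i then 1 else 0) =
      (\<Prod>i\<in>insert i F. if frac (real n * \<theta> i) \<in> A i then 1 else 0) *
      cis (2 * pi * (real n * (\<Sum>i\<in>G. of_int (m i) * \<theta> i)))" for n
    using insert.hyps by (simp add: w_def)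
  ultimately show ?case by simp
qed

text \<open>The case of \<open>has_mean_box\<close> without characters. Since only the interior and
  the closure of \<open>A i\<close> are constrained, open, closed and half-open arcs are covered
  alike.\<close>

theorem equidistribution_box:
  fixes \<theta> :: "'i \<Rightarrow> real"
  assumes H: "finite H" and indep: "independent_mod_1 H \<theta>"
    and box: "\<forall>i\<in>H. 0 \<le> l i \<and> l i \<le> u i \<and> u i \<le> 1 \<and> {l i<..<u i} \<subseteq> A i \<and> A i \<subseteq> {l i..u i}"
  shows "(\<lambda>N. real (card {n \<in> {1..N}. \<forall>i\<in>H. frac (real n * \<theta> i) \<in> A i}) / real N)
    \<longlonglongrightarrow> (\<Prod>i\<in>H. u i - l i)"
proof -
  have prod_ind: "(\<Prod>i\<in>H. if frac (real n * \<theta> i) \<in> A i then 1 else 0 :: complex)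
      = (if \<forall>i\<in>H. frac (real n * \<theta> i) \<in> A i then 1 else 0)" for n
    using H by auto
  have "has_mean (\<lambda>n. (\<Prod>i\<in>H. if frac (real n * \<theta> i) \<in> A i then 1 else 0) *
      cis (2 * pi * (real n * (\<Sum>i\<in>{}. of_int 0 * \<theta> i))))
      (if \<forall>i\<in>({}::'i set). (0::int) = 0 then complex_of_real (\<Prod>i\<in>H. u i - l i) else 0)"
    using has_mean_box[OF H indep box, of H "{}" "\<lambda>_. 0"] by simp
  then have "(\<lambda>N. (\<Sum>n=1..N. if \<forall>i\<in>H. frac (real n * \<theta> i) \<in> A i then 1 else 0) / of_nat N)
      \<longlonglongrightarrow> complex_of_real (\<Prod>i\<in>H. u i - l i)"
    by (simp add: has_mean_def prod_ind)
  moreover have "(\<Sum>n=1..N. if \<forall>i\<in>H. frac (real n * \<theta> i) \<in> A i then 1 else 0) / of_nat N =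
      complex_of_real (real (card {n \<in> {1..N}. \<forall>i\<in>H. frac (real n * \<theta> i) \<in> A i}) / real N)" for N
    by (simp add: sum.inter_filter[symmetric])
  ultimately show ?thesis by (simp only: tendsto_of_real_iff)
qed

section \<open>Windows between consecutive powers\<close>

text \<open>After division by \<open>l\<close> the window lies strictly to the right of
  \<open>t\<close> and has right end at most \<open>t + 1\<close>, so the only integer it can
  contain is \<open>\<lfloor>t\<rfloor> + 1\<close>.\<close>

lemma multiple_in_window_iff_frac:
  fixes l c d :: real
  assumes "l > 0" "0 \<le> c" "d \<le> l"
  shows "(\<exists>a::nat. a \<ge> 1 \<and> real n + c < real a * l \<and> real a * l < real n + d) \<longleftrightarrow>
    1 - d / l < frac (real n * (1 / l)) \<and> frac (real n * (1 / l)) < 1 - c / l"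
proof -
  define t where "t = real n * (1 / l)"
  define f where "f = \<lfloor>t\<rfloor>"
  have t0: "t \<ge> 0" using assms by (simp add: t_def)
  have fr: "frac t = t - of_int f" by (simp add: frac_def f_def)
  have f: "of_int f \<le> t" "t < of_int f + 1" by (simp_all add: f_def)
  have cl: "0 \<le> c / l" "d / l \<le> 1" using assms by simp_all
  have window: "real n + c < y * l \<and> y * l < real n + d \<longleftrightarrow> t + c / l < y \<and> y < t + d / l" for y
    using assms by (simp add: t_def field_simps)
  show ?thesis
  proof
    assume "\<exists>a::nat. a \<ge> 1 \<and> real n + c < real a * l \<and> real a * l < real n + d"
    then obtain a :: nat where a: "t + c / l < real a" "real a < t + d / l" using window by blast
    have "of_int f < real a" "real a < of_int f + 2" using a f cl by linarith+
    then have "int a = f + 1" by linarith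
    then have "real a = of_int f + 1" by (metis of_int_add of_int_1 of_int_of_nat_eq)
    then show "1 - d / l < frac (real n * (1 / l)) \<and> frac (real n * (1 / l)) < 1 - c / l"
      using a fr unfolding t_def[symmetric] by linarith
  next
    assume *: "1 - d / l < frac (real n * (1 / l)) \<and> frac (real n * (1 / l)) < 1 - c / l"
    have "f \<ge> 0" using t0 by (simp add: f_def)
    then have a: "real (nat (f + 1)) = of_int f + 1" by simp
    have "t + c / l < real (nat (f + 1)) \<and> real (nat (f + 1)) < t + d / l"
      using * fr unfolding a t_def[symmetric] by linarith
    then have "real n + c < real (nat (f + 1)) * l \<and> real (nat (f + 1)) * l < real n + d"
      using window by blast
    moreover have "nat (f + 1) \<ge> 1" using \<open>f \<ge> 0\<close> by simp
    ultimately show "\<exists>a::nat. a \<ge> 1 \<and> real n + c < real a * l \<and> real a * l < real n + d" by blast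
  qed
qed

lemma power_less_power_iff:
  fixes x y :: real
  assumes "0 \<le> x" "0 \<le> y" "k > 0"
  shows "x ^ k < y ^ k \<longleftrightarrow> x < y"
  using assms by (meson power_less_imp_less_base power_strict_mono)

text \<open>Taking \<open>k\<close>-th roots turns the window of powers into a linear one.
  Conversely \<open>(a * l) ^ k\<close> is a natural number because \<open>l ^ k\<close> is.\<close>

lemma S_set_window_image:
  assumes L: "L \<subseteq> Lambda k" and k: "k \<ge> 2"
  shows "real ` {m \<in> S_set k L. X ^ k < m \<and> m < Y ^ k} =
    (\<lambda>(a, l). (real a * l) ^ k) ` {(a::nat, l). a \<ge> 1 \<and> l \<in> L \<and> real X < real a * l \<and> real a * l < real Y}"
    (is "real ` ?W = ?f ` ?P")
proof -
  have cmp: "X ^ k < m \<and> m < Y ^ k \<longleftrightarrow> real X < real a * l \<and> real a * l < real Y"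
    if "real m = (real a * l) ^ k" "l \<in> L" for m a l
  proof -
    have l: "l > 0" using Lambda_gt_2[of l k] that L k by auto
    have "X ^ k < m \<longleftrightarrow> real X ^ k < (real a * l) ^ k"
      using that(1) by (metis of_nat_less_iff of_nat_power)
    also have "\<dots> \<longleftrightarrow> real X < real a * l"
      using k l by (intro power_less_power_iff) auto
    finally have 1: "X ^ k < m \<longleftrightarrow> real X < real a * l" .
    have "m < Y ^ k \<longleftrightarrow> (real a * l) ^ k < real Y ^ k"
      using that(1) by (metis of_nat_less_iff of_nat_power)
    also have "\<dots> \<longleftrightarrow> real a * l < real Y"
      using k l by (intro power_less_power_iff) auto
    finally show ?thesis using 1 by simp
  qed
  show ?thesis
  proof (intro equalityI subsetI)
    fix y assume "y \<in> real ` ?W"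
    then obtain m a l where m: "y = real m" "X ^ k < m" "m < Y ^ k" "a \<ge> 1" "l \<in> L" "real m = (real a * l) ^ k"
      by (auto simp: S_set_def)
    then have "(a, l) \<in> ?P" using cmp[of m a l] by simp
    moreover have "y = ?f (a, l)" using m by simp
    ultimately show "y \<in> ?f ` ?P" by (rule rev_image_eqI)
  next
    fix y assume "y \<in> ?f ` ?P"
    then obtain a l where al: "y = (real a * l) ^ k" "a \<ge> 1" "l \<in> L" "real X < real a * l" "real a * l < real Y"
      by auto
    obtain N where N: "l ^ k = real N" using Lambda_power[of l k] al(3) L k by blast
    have m: "real (a ^ k * N) = (real a * l) ^ k" by (simp add: power_mult_distrib N)
    then have "a ^ k * N \<in> ?W" using cmp[OF m al(3)] al by (auto simp: S_set_def)
    then show "y \<in> real ` ?W" by (rule image_eqI[rotated]) (simp only: m al(1))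
  qed
qed

text \<open>Elements in the window correspond to pairs \<open>(a, l)\<close>. As
  \<open>l > 2\<close> exceeds the window length, each \<open>l\<close> occurs in at most one pair,
  so the count is the number of \<open>l\<close> hit and reaches \<open>card L\<close> only if all
  are hit.\<close>

lemma card_S_set_window_eq_iff:
  assumes L: "L \<subseteq> Lambda k" "finite L" and k: "k \<ge> 2" and XY: "Y \<le> X + 2"
  shows "card {m \<in> S_set k L. X ^ k < m \<and> m < Y ^ k} = card L \<longleftrightarrow>
    (\<forall>l\<in>L. \<exists>a::nat. a \<ge> 1 \<and> real X < real a * l \<and> real a * l < real Y)"
proof -
  define P where "P = {(a::nat, l). a \<ge> 1 \<and> l \<in> L \<and> real X < real a * l \<and> real a * l < real Y}"
  have gt2: "l > 2" if "l \<in> L" for l using Lambda_gt_2[of l k] that L k by auto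
  have "card {m \<in> S_set k L. X ^ k < m \<and> m < Y ^ k} = card (real ` {m \<in> S_set k L. X ^ k < m \<and> m < Y ^ k})"
    by (simp add: card_image inj_on_def)
  also have "\<dots> = card ((\<lambda>(a, l). (real a * l) ^ k) ` P)"
    unfolding S_set_window_image[OF L(1) k] P_def ..
  also have "\<dots> = card P"
  proof (rule card_image, rule inj_onI, clarify)
    fix a l a' l' assume P: "(a, l) \<in> P" "(a', l') \<in> P" and eq: "(real a * l) ^ k = (real a' * l') ^ k"
    have "l \<in> L" "l' \<in> L" "a \<ge> 1" "a' \<ge> 1" using P by (auto simp: P_def)
    then have pos: "l > 2" "l' > 2" "a > 0" "a' > 0" using gt2 by auto
    have "real a * l = real a' * l'" by (rule power_eq_imp_eq_base[OF eq]) (use k pos in auto)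
    then have "l = l'" using Lambda_multiples_eq[of l k l' a a'] pos P L k by (auto simp: P_def)
    then show "a = a' \<and> l = l'" using \<open>real a * l = real a' * l'\<close> pos by simp
  qed
  also have "\<dots> = card (snd ` P)"
  proof (rule card_image[symmetric], rule inj_onI, clarify)
    fix a l a' l' assume P: "(a, l) \<in> P" "(a', l') \<in> P" and eq: "snd (a, l) = snd (a', l')"
    have l: "l' = l" "l > 2" using P eq gt2 by (auto simp: P_def)
    have "a = a'"
    proof (rule ccontr)
      assume "a \<noteq> a'"
      then have "1 \<le> \<bar>real a - real a'\<bar>" by linarith
      then have "l \<le> \<bar>real a - real a'\<bar> * l" using l by simp
      also have "\<dots> = \<bar>real a * l - real a' * l\<bar>" using l by (simp add: abs_mult left_diff_distrib[symmetric])
      also have "\<dots> < 2"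
      proof -
        have "real X < real a * l" "real a * l < real Y" "real X < real a' * l" "real a' * l < real Y" "real Y \<le> real X + 2"
          using P l XY by (auto simp: P_def)
        then show ?thesis by linarith
      qed
      finally show False using l by simp
    qed
    then show "a = a' \<and> l = l'" using l by simp
  qed
  finally have card: "card {m \<in> S_set k L. X ^ k < m \<and> m < Y ^ k} = card (snd ` P)" .
  have sub: "snd ` P \<subseteq> L" by (auto simp: P_def)
  have "card (snd ` P) = card L \<longleftrightarrow> snd ` P = L"
    using card_subset_eq[OF L(2) sub] by auto
  also have "\<dots> \<longleftrightarrow> (\<forall>l\<in>L. \<exists>a::nat. a \<ge> 1 \<and> real X < real a * l \<and> real a * l < real Y)"
  proof -
    have "snd ` P = {l \<in> L. \<exists>a::nat. a \<ge> 1 \<and> real X < real a * l \<and> real a * l < real Y}"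
      unfolding P_def by force
    then show ?thesis by blast
  qed
  finally show ?thesis unfolding card .
qed

lemma S_set_window_empty_iff:
  assumes L: "L \<subseteq> Lambda k" and k: "k \<ge> 2"
  shows "{m \<in> S_set k L. X ^ k < m \<and> m < Y ^ k} = {} \<longleftrightarrow>
    (\<forall>l\<in>L. \<not> (\<exists>a::nat. a \<ge> 1 \<and> real X < real a * l \<and> real a * l < real Y))"
proof -
  have "{m \<in> S_set k L. X ^ k < m \<and> m < Y ^ k} = {} \<longleftrightarrow> real ` {m \<in> S_set k L. X ^ k < m \<and> m < Y ^ k} = {}"
    by blast
  also have "\<dots> \<longleftrightarrow> (\<forall>l\<in>L. \<not> (\<exists>a::nat. a \<ge> 1 \<and> real X < real a * l \<and> real a * l < real Y))"
    unfolding S_set_window_image[OF L k] by auto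
  finally show ?thesis .
qed

text \<open>The arcs come from the windows \<open>(n, n + 1)\<close> and
  \<open>(n + 1, n + 2)\<close>; the third is the complement in \<open>[0, 1)\<close> of the arc for
  \<open>(n, n + 2)\<close>, hence closed.\<close>

definition target_arc :: "real set \<Rightarrow> real set \<Rightarrow> real \<Rightarrow> real set" where
  "target_arc I J l = (if l \<in> I then {1 - 1 / l<..<1} else if l \<in> J then {1 - 2 / l<..<1 - 1 / l} else {0..1 - 2 / l})"

lemma B_set_iff_frac:
  assumes k: "k \<ge> 2" and fin: "finite I" "finite J" and sub: "I \<subseteq> Lambda k" "J \<subseteq> Lambda k" and disj: "I \<inter> J = {}"
  shows "n \<in> B_set k I J \<longleftrightarrow> n \<ge> 1 \<and> (\<forall>l\<in>Lambda k. frac (real n * (1 / l)) \<in> target_arc I J l)"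
proof -
  have gt2: "l > 2" if "l \<in> Lambda k" for l using Lambda_gt_2(1)[OF that k] .
  have I: "card {m \<in> S_set k I. n ^ k < m \<and> m < (n+1) ^ k} = card I \<longleftrightarrow>
      (\<forall>l\<in>I. frac (real n * (1 / l)) \<in> target_arc I J l)"
  proof -
    have "(\<exists>a::nat. a \<ge> 1 \<and> real n < real a * l \<and> real a * l < real (n + 1)) \<longleftrightarrow>
        frac (real n * (1 / l)) \<in> target_arc I J l" if "l \<in> I" for l
    proof -
      have "l > 2" using gt2 that sub by blast
      then show ?thesis
        using multiple_in_window_iff_frac[of l 0 1 n] that frac_lt_1[of "real n * (1 / l)"]
        by (simp add: target_arc_def add.commute)
    qed
    then show ?thesis using card_S_set_window_eq_iff[OF sub(1) fin(1) k, of "n + 1" n] by simp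
  qed
  have J: "card {m \<in> S_set k J. (n+1) ^ k < m \<and> m < (n+2) ^ k} = card J \<longleftrightarrow>
      (\<forall>l\<in>J. frac (real n * (1 / l)) \<in> target_arc I J l)"
  proof -
    have "(\<exists>a::nat. a \<ge> 1 \<and> real (n + 1) < real a * l \<and> real a * l < real (n + 2)) \<longleftrightarrow>
        frac (real n * (1 / l)) \<in> target_arc I J l" if "l \<in> J" for l
    proof -
      have "l > 2" "l \<notin> I" using gt2 that sub disj by blast+
      then show ?thesis
        using multiple_in_window_iff_frac[of l 1 2 n] that
        by (simp add: target_arc_def add.commute)
    qed
    then show ?thesis using card_S_set_window_eq_iff[OF sub(2) fin(2) k, of "n + 2" "n + 1"] by simp
  qed
  have R: "{m \<in> S_set k (Lambda k - (I \<union> J)). n ^ k < m \<and> m < (n+2) ^ k} = {} \<longleftrightarrow>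
      (\<forall>l\<in>Lambda k - (I \<union> J). frac (real n * (1 / l)) \<in> target_arc I J l)"
  proof -
    have "\<not> (\<exists>a::nat. a \<ge> 1 \<and> real n < real a * l \<and> real a * l < real (n + 2)) \<longleftrightarrow>
        frac (real n * (1 / l)) \<in> target_arc I J l" if "l \<in> Lambda k - (I \<union> J)" for l
    proof -
      have "l > 2" "l \<notin> I" "l \<notin> J" using gt2 that by blast+
      then show ?thesis
        using multiple_in_window_iff_frac[of l 0 2 n] frac_lt_1[of "real n * (1 / l)"]
        by (simp add: target_arc_def add.commute not_less)
    qed
    then show ?thesis using S_set_window_empty_iff[of "Lambda k - (I \<union> J)" k n "n + 2"] k by simp
  qed
  show ?thesis unfolding B_set_def mem_Collect_eq I J R using sub by auto
qed

section \<open>Union bound for the tail of the conditions\<close>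

lemma card_nat_window_le_2: "finite {n::nat. real n < y \<and> y < real n + 2}" "card {n::nat. real n < y \<and> y < real n + 2} \<le> 2"
proof -
  have sub: "{n::nat. real n < y \<and> y < real n + 2} \<subseteq> {nat \<lfloor>y\<rfloor>, nat \<lfloor>y\<rfloor> - 1}"
  proof
    fix n assume "n \<in> {n::nat. real n < y \<and> y < real n + 2}"
    then have "\<lfloor>y\<rfloor> = int n \<or> \<lfloor>y\<rfloor> = int n + 1" unfolding mem_Collect_eq by linarith
    then show "n \<in> {nat \<lfloor>y\<rfloor>, nat \<lfloor>y\<rfloor> - 1}" by auto
  qed
  then show "finite {n::nat. real n < y \<and> y < real n + 2}" by (rule finite_subset) simp
  have "card {n::nat. real n < y \<and> y < real n + 2} \<le> card {nat \<lfloor>y\<rfloor>, nat \<lfloor>y\<rfloor> - 1}"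
    using sub by (intro card_mono) auto
  also have "\<dots> \<le> 2" by (rule order.trans[OF card_insert_le_m1]) auto
  finally show "card {n::nat. real n < y \<and> y < real n + 2} \<le> 2" .
qed

text \<open>Each \<open>l\<close> has at most \<open>(N + 2) / l\<close> positive multiples up to
  \<open>N + 2\<close>, and each multiple lies in the window of at most two
  \<open>n\<close>.\<close>

lemma card_hit_by_tail_le:
  fixes R :: "real set"
  assumes pos: "\<And>l. l \<in> R \<Longrightarrow> l > 0"
    and tail: "\<And>F. finite F \<Longrightarrow> F \<subseteq> R \<Longrightarrow> (\<Sum>l\<in>F. 1 / l) \<le> \<epsilon>"
  shows "real (card {n \<in> {1..N}. \<exists>l\<in>R. \<exists>a::nat. a \<ge> 1 \<and> real n < real a * l \<and> real a * l < real n + 2}) \<le> 2 * (real N + 2) * \<epsilon>"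
proof -
  define L where "L = {l \<in> R. l < real N + 2}"
  define T where "T = {n \<in> {1..N}. \<exists>l\<in>R. \<exists>a::nat. a \<ge> 1 \<and> real n < real a * l \<and> real a * l < real n + 2}"
  \<comment> \<open>Every element of \<open>L\<close> contributes more than
    \<open>1 / (N + 2)\<close> to sums bounded by \<open>\<epsilon>\<close>, which limits the size
    of finite subsets of \<open>L\<close>.\<close>
  have "finite L"
  proof (rule conjunct1[OF finite_if_finite_subsets_card_bdd])
    fix F assume F: "F \<subseteq> L" "finite F"
    have "real (card F) / (real N + 2) = (\<Sum>l\<in>F. 1 / (real N + 2))" by simp
    also have "\<dots> \<le> (\<Sum>l\<in>F. 1 / l)"
      using F pos by (intro sum_mono divide_left_mono) (auto simp: L_def intro!: mult_pos_pos)
    also have "\<dots> \<le> \<epsilon>" using F by (intro tail) (auto simp: L_def)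
    finally have "real (card F) \<le> \<epsilon> * (real N + 2)" by (simp add: field_simps)
    then show "card F \<le> nat \<lfloor>\<epsilon> * (real N + 2)\<rfloor>" by (simp add: le_nat_floor)
  qed
  define W where "W y = {n::nat. real n < y \<and> y < real n + 2}" for y
  define U where "U = (\<Union>l\<in>L. \<Union>a\<in>{1..nat \<lfloor>(real N + 2) / l\<rfloor>}. W (real a * l))"
  have "finite U" unfolding U_def W_def using \<open>finite L\<close> card_nat_window_le_2(1) by auto
  have "T \<subseteq> U"
  proof
    fix n assume "n \<in> T"
    then obtain l a where n: "n \<in> {1..N}" "l \<in> R" "a \<ge> 1" "real n < real a * l" "real a * l < real n + 2"
      by (auto simp: T_def)
    have l: "l > 0" using pos n by simp
    have al: "real a * l < real N + 2" using n by auto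
    moreover have "1 * l \<le> real a * l" using n l by (intro mult_right_mono) auto
    ultimately have "l \<in> L" using n by (simp add: L_def)
    moreover have "real a \<le> (real N + 2) / l" using al l by (simp add: field_simps)
    then have "a \<in> {1..nat \<lfloor>(real N + 2) / l\<rfloor>}" using n by (simp add: le_nat_floor)
    moreover have "n \<in> W (real a * l)" using n by (simp add: W_def)
    ultimately show "n \<in> U" unfolding U_def by blast
  qed
  then have "card T \<le> card U" using \<open>finite U\<close> by (intro card_mono)
  also have "card U \<le> (\<Sum>l\<in>L. card (\<Union>a\<in>{1..nat \<lfloor>(real N + 2) / l\<rfloor>}. W (real a * l)))"
    unfolding U_def using \<open>finite L\<close> by (rule card_UN_le)
  also have "\<dots> \<le> (\<Sum>l\<in>L. 2 * nat \<lfloor>(real N + 2) / l\<rfloor>)"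
  proof (intro sum_mono)
    fix l
    have "card (\<Union>a\<in>{1..nat \<lfloor>(real N + 2) / l\<rfloor>}. W (real a * l)) \<le> (\<Sum>a\<in>{1..nat \<lfloor>(real N + 2) / l\<rfloor>}. card (W (real a * l)))"
      by (intro card_UN_le) simp
    also have "\<dots> \<le> (\<Sum>a\<in>{1..nat \<lfloor>(real N + 2) / l\<rfloor>}. 2)"
      unfolding W_def by (intro sum_mono card_nat_window_le_2)
    finally show "card (\<Union>a\<in>{1..nat \<lfloor>(real N + 2) / l\<rfloor>}. W (real a * l)) \<le> 2 * nat \<lfloor>(real N + 2) / l\<rfloor>" by simp
  qed
  finally have "real (card T) \<le> real (\<Sum>l\<in>L. 2 * nat \<lfloor>(real N + 2) / l\<rfloor>)" by (rule of_nat_mono)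
  also have "\<dots> = (\<Sum>l\<in>L. 2 * real (nat \<lfloor>(real N + 2) / l\<rfloor>))" by simp
  also have "\<dots> \<le> (\<Sum>l\<in>L. 2 * ((real N + 2) / l))"
  proof (intro sum_mono mult_left_mono)
    fix l assume "l \<in> L"
    then have "0 \<le> (real N + 2) / l" using pos[of l] by (auto simp: L_def)
    then show "real (nat \<lfloor>(real N + 2) / l\<rfloor>) \<le> (real N + 2) / l" by (rule of_nat_floor)
  qed simp
  also have "\<dots> = 2 * (real N + 2) * (\<Sum>l\<in>L. 1 / l)" by (simp add: sum_distrib_left)
  also have "\<dots> \<le> 2 * (real N + 2) * \<epsilon>"
    using \<open>finite L\<close> by (intro mult_left_mono tail) (auto simp: L_def)
  finally show ?thesis unfolding T_def .
qed

section \<open>Convergence and density\<close>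

text \<open>\<open>1 / l\<close> factors as the product of \<open>b i\<close> to the power
  \<open>- (1 + i / k)\<close>. Dropping squarefreeness and expanding, every finite partial sum is
  at most a product of convergent zeta series.\<close>

lemma summable_on_inverse_Lambda:
  assumes k: "k \<ge> 2"
  shows "(\<lambda>l. 1 / l) summable_on Lambda k"
proof (rule nonneg_bdd_above_summable_on)
  show "0 \<le> 1 / l" if "l \<in> Lambda k" for l using Lambda_gt_2(1)[OF that k] by simp
  define s where "s i = - (1 + real i / real k)" for i
  \<comment> \<open>The term at 0 is harmless, since \<open>0 powr s i = 0\<close>.\<close>
  define C where "C = (\<Prod>i\<in>{1..k-1}. \<Sum>n. real n powr s i)"
  show "bdd_above (sum (\<lambda>l. 1 / l) ` {F. F \<subseteq> Lambda k \<and> finite F})"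
  proof (rule bdd_aboveI2[where M=C], clarify)
    fix F assume F: "F \<subseteq> Lambda k" "finite F"
    \<comment> \<open>Extensional tuples are chosen so that they belong to the function set over
      which \<open>prod_sum_PiE\<close> expands the product of sums.\<close>
    have "\<exists>b. b \<in> extensional {1..k-1} \<and> 1 / l = (\<Prod>i\<in>{1..k-1}. real (b i) powr s i)" if "l \<in> F" for l
    proof -
      from that F obtain b :: "nat \<Rightarrow> nat" where b: "\<forall>i\<in>{1..k-1}. b i \<ge> 1"
          and l_eq: "l = root k (real (\<Prod>i\<in>{1..k-1}. b i ^ (k + i)))"
        by (auto simp: Lambda_def)
      have bpos: "real (b i) > 0" if "i \<in> {1..k-1}" for i using b[rule_format, OF that] by simp
      have "l = real (\<Prod>i\<in>{1..k-1}. b i ^ (k + i)) powr (1 / real k)"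
        unfolding l_eq using k by (intro root_powr_inverse of_nat_0_le_iff) simp
      also have "\<dots> = (\<Prod>i\<in>{1..k-1}. real (b i) ^ (k + i)) powr (1 / real k)" by simp
      also have "\<dots> = (\<Prod>i\<in>{1..k-1}. (real (b i) ^ (k + i)) powr (1 / real k))"
        by (rule prod_powr_distrib)
      finally have "1 / l = (\<Prod>i\<in>{1..k-1}. 1 / (real (b i) ^ (k + i)) powr (1 / real k))"
        by (simp add: prod_dividef)
      also have "\<dots> = (\<Prod>i\<in>{1..k-1}. real (restrict b {1..k-1} i) powr s i)"
      proof (rule prod.cong[OF refl])
        fix i assume i: "i \<in> {1..k-1}"
        have "(real (b i) ^ (k + i)) powr (1 / real k) = real (b i) powr (real (k + i) * (1 / real k))"
          using bpos[OF i] by (simp add: powr_powr flip: powr_realpow)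
        also have "real (k + i) * (1 / real k) = - s i" using k by (simp add: s_def field_simps)
        finally show "1 / (real (b i) ^ (k + i)) powr (1 / real k) = real (restrict b {1..k-1} i) powr s i"
          using i by (simp add: powr_minus_divide)
      qed
      finally show ?thesis by (intro exI[of _ "restrict b {1..k-1}"]) simp
    qed
    then obtain b :: "real \<Rightarrow> nat \<Rightarrow> nat" where b: "\<And>l. l \<in> F \<Longrightarrow> b l \<in> extensional {1..k-1}"
        "\<And>l. l \<in> F \<Longrightarrow> 1 / l = (\<Prod>i\<in>{1..k-1}. real (b l i) powr s i)"
      by metis
    have inj: "inj_on b F"
    proof (rule inj_onI)
      fix x y assume "x \<in> F" "y \<in> F" "b x = b y"
      then have "1 / x = 1 / y" using b(2) by metis
      then show "x = y" by simp
    qed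
    define M where "M = Max (insert 0 ((\<lambda>(l, i). b l i) ` (F \<times> {1..k-1})))"
    have M: "b l i \<le> M" if "l \<in> F" "i \<in> {1..k-1}" for l i
      unfolding M_def using F that by (intro Max_ge) auto
    have "(\<Sum>l\<in>F. 1 / l) = (\<Sum>l\<in>F. \<Prod>i\<in>{1..k-1}. real (b l i) powr s i)"
      using b(2) by (intro sum.cong) auto
    also have "\<dots> = (\<Sum>g\<in>b ` F. \<Prod>i\<in>{1..k-1}. real (g i) powr s i)"
      by (simp add: sum.reindex[OF inj])
    also have "\<dots> \<le> (\<Sum>g\<in>{1..k-1} \<rightarrow>\<^sub>E {..M}. \<Prod>i\<in>{1..k-1}. real (g i) powr s i)"
    proof (intro sum_mono2 finite_PiE prod_nonneg)
      have "b l \<in> {1..k-1} \<rightarrow>\<^sub>E {..M}" if "l \<in> F" for l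
        using b(1)[OF that] M[OF that] unfolding PiE_iff by blast
      then show "b ` F \<subseteq> {1..k-1} \<rightarrow>\<^sub>E {..M}" by blast
    qed auto
    also have "\<dots> = (\<Prod>i\<in>{1..k-1}. \<Sum>n\<le>M. real n powr s i)"
      by (simp add: prod_sum_PiE)
    also have "\<dots> \<le> C" unfolding C_def
    proof (intro prod_mono conjI sum_nonneg sum_le_suminf)
      fix i assume i: "i \<in> {1..k-1}"
      then have "s i < - 1" using k by (simp add: s_def)
      then show "summable (\<lambda>n. real n powr s i)" by (simp add: summable_real_powr_iff)
    qed auto
    finally show "(\<Sum>l\<in>F. 1 / l) \<le> C" .
  qed
qed

text \<open>The product is the exponential of a sum of logarithms, which makes it positive. With
  \<open>x = 2 / l \<le> t < 1\<close> one has \<open>- ln (1 - x) \<le> x / (1 - t)\<close>, so the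
  sum converges by comparison with \<open>1 / l\<close>.\<close>

lemma has_prod_set_Lambda:
  assumes k: "k \<ge> 2" and R: "R \<subseteq> Lambda k"
  obtains P where "has_prod_set (\<lambda>l. 1 - 2 / l) R P" "P > 0"
proof -
  define t where "t = 2 / root k (2 ^ (k + 1))"
  have "2 < root k (2 ^ (k + 1))"
  proof -
    have "root k (2 ^ k) < root k (2 ^ (k + 1))" using k by (intro real_root_less_mono) auto
    then show ?thesis using k by (simp add: real_root_power_cancel)
  qed
  then have t: "0 < t" "t < 1" by (simp_all add: t_def)
  have bound: "0 \<le> - ln (1 - 2 / l) \<and> - ln (1 - 2 / l) \<le> 1 / l * (2 / (1 - t)) \<and> 1 - 2 / l > 0" if "l \<in> R" for l
  proof -
    have l: "l > 2" "l \<ge> root k (2 ^ (k + 1))" using Lambda_gt_2[of l k] that R k by auto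
    define x where "x = 2 / l"
    have "x \<le> t" unfolding x_def t_def using l \<open>2 < root k (2 ^ (k + 1))\<close> by (intro divide_left_mono) auto
    moreover have "x > 0" using l by (simp add: x_def)
    ultimately have x: "0 < x" "x \<le> t" "x < 1" using t by auto
    have "- ln (1 - x) = ln (1 / (1 - x))" using x by (simp add: ln_div)
    also have "\<dots> \<le> 1 / (1 - x) - 1" using x by (intro ln_le_minus_one) simp
    also have "\<dots> = x / (1 - x)" using x by (simp add: field_simps)
    also have "\<dots> \<le> x / (1 - t)" using x t by (intro divide_left_mono) auto
    also have "\<dots> = 1 / l * (2 / (1 - t))" by (simp add: x_def)
    finally show ?thesis using x by (simp add: x_def)
  qed
  have "(\<lambda>l. 1 / l * (2 / (1 - t))) summable_on R"
    by (intro summable_on_cmult_left summable_on_subset_banach[OF summable_on_inverse_Lambda[OF k] R])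
  then have "(\<lambda>l. - ln (1 - 2 / l)) summable_on R"
    by (rule summable_on_comparison_test) (use bound in blast)+
  then obtain s where "((\<lambda>l. - ln (1 - 2 / l)) has_sum s) R" by (auto simp: summable_on_def)
  then have "((\<lambda>F. exp (- (\<Sum>l\<in>F. - ln (1 - 2 / l)))) \<longlongrightarrow> exp (- s)) (finite_subsets_at_top R)"
    unfolding has_sum_def by (intro tendsto_intros)
  moreover have "\<forall>\<^sub>F F in finite_subsets_at_top R. exp (- (\<Sum>l\<in>F. - ln (1 - 2 / l))) = (\<Prod>l\<in>F. 1 - 2 / l)"
  proof (rule eventually_finite_subsets_at_top_weakI)
    fix F assume F: "finite F" "F \<subseteq> R"
    have "exp (- (\<Sum>l\<in>F. - ln (1 - 2 / l))) = (\<Prod>l\<in>F. exp (ln (1 - 2 / l)))"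
      by (simp add: sum_negf exp_sum F)
    also have "\<dots> = (\<Prod>l\<in>F. 1 - 2 / l)" using F bound by (intro prod.cong refl exp_ln) auto
    finally show "exp (- (\<Sum>l\<in>F. - ln (1 - 2 / l))) = (\<Prod>l\<in>F. 1 - 2 / l)" .
  qed
  ultimately have "has_prod_set (\<lambda>l. 1 - 2 / l) R (exp (- s))"
    unfolding has_prod_set_def by (rule Lim_transform_eventually)
  then show thesis using that by simp
qed

text \<open>Counting up to a real \<open>x\<close> is counting up to its floor, and the ratio of
  floor to \<open>x\<close> tends to 1. The condition on 0 matches the two counts, one of which
  starts at 1.\<close>

lemma has_density_sequentially:
  assumes lim: "(\<lambda>N. real (card {n \<in> {1..N}. n \<in> A}) / real N) \<longlonglongrightarrow> d" and A: "0 \<notin> A"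
  shows "has_density A d"
proof -
  define g where "g N = real (card {n \<in> {1..N}. n \<in> A}) / real N" for N
  have nf: "filterlim (\<lambda>x::real. nat \<lfloor>x\<rfloor>) sequentially at_top"
    by (rule filterlim_compose[OF filterlim_nat_sequentially filterlim_floor_sequentially])
  have "((\<lambda>x::real. g (nat \<lfloor>x\<rfloor>)) \<longlongrightarrow> d) at_top"
    using filterlim_compose[OF lim[folded g_def] nf] by simp
  moreover have "((\<lambda>x::real. real (nat \<lfloor>x\<rfloor>) / x) \<longlongrightarrow> 1) at_top"
  proof (rule tendsto_sandwich)
    show "\<forall>\<^sub>F x::real in at_top. 1 - inverse x \<le> real (nat \<lfloor>x\<rfloor>) / x"
      using eventually_ge_at_top[of 1]
    proof eventually_elim
      case (elim x)
      have "x - 1 \<le> real (nat \<lfloor>x\<rfloor>)" using elim by linarith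
      then have "(x - 1) / x \<le> real (nat \<lfloor>x\<rfloor>) / x" using elim by (intro divide_right_mono) auto
      moreover have "(x - 1) / x = 1 - inverse x" using elim by (simp add: field_simps)
      ultimately show ?case by simp
    qed
    show "\<forall>\<^sub>F x::real in at_top. real (nat \<lfloor>x\<rfloor>) / x \<le> 1"
      using eventually_ge_at_top[of 1] by eventually_elim (simp add: of_nat_floor)
    have "((\<lambda>x::real. 1 - inverse x) \<longlongrightarrow> 1 - 0) at_top"
      by (intro tendsto_diff tendsto_const tendsto_inverse_0_at_top filterlim_ident)
    then show "((\<lambda>x::real. 1 - inverse x) \<longlongrightarrow> 1) at_top" by simp
  qed simp
  ultimately have "((\<lambda>x::real. g (nat \<lfloor>x\<rfloor>) * (real (nat \<lfloor>x\<rfloor>) / x)) \<longlongrightarrow> d * 1) at_top"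
    by (rule tendsto_mult)
  moreover have "\<forall>\<^sub>F x::real in at_top. g (nat \<lfloor>x\<rfloor>) * (real (nat \<lfloor>x\<rfloor>) / x) = real (count_upto A x) / x"
    using eventually_ge_at_top[of 1]
  proof eventually_elim
    case (elim x)
    have "{m \<in> A. real m \<le> x} = {n \<in> {1..nat \<lfloor>x\<rfloor>}. n \<in> A}"
    proof (intro equalityI subsetI)
      fix m assume m: "m \<in> {m \<in> A. real m \<le> x}"
      then have "m \<noteq> 0" using A by (metis (mono_tags) mem_Collect_eq)
      then have "m \<ge> 1" by simp
      then show "m \<in> {n \<in> {1..nat \<lfloor>x\<rfloor>}. n \<in> A}" using m by (simp add: le_nat_floor)
    next
      fix m assume m: "m \<in> {n \<in> {1..nat \<lfloor>x\<rfloor>}. n \<in> A}"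
      then have "real m \<le> real (nat \<lfloor>x\<rfloor>)" by simp
      also have "\<dots> \<le> x" using elim by (simp add: of_nat_floor)
      finally show "m \<in> {m \<in> A. real m \<le> x}" using m by simp
    qed
    moreover have "real (nat \<lfloor>x\<rfloor>) \<noteq> 0" using le_nat_floor[of 1 x] elim by simp
    ultimately show ?case by (simp add: g_def count_upto_def)
  qed
  ultimately show ?thesis unfolding has_density_def
    using Lim_transform_eventually by fastforce
qed

section \<open>Passage from finitely many conditions to the density\<close>

lemma target_arc_equidistribution:
  assumes k: "k \<ge> 2" and H: "finite H" "H \<subseteq> Lambda k" "I \<union> J \<subseteq> H"
  shows "(\<lambda>N. real (card {n \<in> {1..N}. \<forall>l\<in>H. frac (real n * (1 / l)) \<in> target_arc I J l}) / real N)
    \<longlonglongrightarrow> (\<Prod>l\<in>I \<union> J. 1 / l) * (\<Prod>l\<in>H - (I \<union> J). 1 - 2 / l)"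
proof -
  define lo where "lo l = (if l \<in> I then 1 - 1 / l else if l \<in> J then 1 - 2 / l else 0)" for l :: real
  define hi where "hi l = (if l \<in> I then 1 else if l \<in> J then 1 - 1 / l else 1 - 2 / l)" for l :: real
  have "independent_mod_1 H (\<lambda>l. 1 / l)"
    unfolding independent_mod_1_def using Lambda_inverses_independent[OF H(1,2) k] by blast
  moreover have "\<forall>l\<in>H. 0 \<le> lo l \<and> lo l \<le> hi l \<and> hi l \<le> 1 \<and>
      {lo l<..<hi l} \<subseteq> target_arc I J l \<and> target_arc I J l \<subseteq> {lo l..hi l}"
  proof
    fix l assume "l \<in> H"
    then have "l > 2" using Lambda_gt_2(1) H k by blast
    define p q where "p = 1 / l" and "q = 2 / l"
    have "0 < p" "p \<le> q" "q \<le> 1"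
      using \<open>l > 2\<close> by (simp_all add: p_def q_def divide_right_mono)
    then show "0 \<le> lo l \<and> lo l \<le> hi l \<and> hi l \<le> 1 \<and>
      {lo l<..<hi l} \<subseteq> target_arc I J l \<and> target_arc I J l \<subseteq> {lo l..hi l}"
      unfolding lo_def hi_def target_arc_def p_def[symmetric] q_def[symmetric]
      by (cases "l \<in> I"; cases "l \<in> J") (simp_all add: less_imp_le subset_iff)
  qed
  ultimately have "(\<lambda>N. real (card {n \<in> {1..N}. \<forall>l\<in>H. frac (real n * (1 / l)) \<in> target_arc I J l}) / real N)
      \<longlonglongrightarrow> (\<Prod>l\<in>H. hi l - lo l)"
    by (intro equidistribution_box H)
  moreover have "(\<Prod>l\<in>H. hi l - lo l) = (\<Prod>l\<in>I \<union> J. hi l - lo l) * (\<Prod>l\<in>H - (I \<union> J). hi l - lo l)"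
    using prod.subset_diff[OF H(3,1), of "\<lambda>l. hi l - lo l"] by (simp add: mult.commute)
  moreover have "(\<Prod>l\<in>I \<union> J. hi l - lo l) = (\<Prod>l\<in>I \<union> J. 1 / l)"
    by (intro prod.cong) (auto simp: hi_def lo_def field_simps)
  moreover have "(\<Prod>l\<in>H - (I \<union> J). hi l - lo l) = (\<Prod>l\<in>H - (I \<union> J). 1 - 2 / l)"
    by (intro prod.cong) (auto simp: hi_def lo_def)
  ultimately show ?thesis by simp
qed

text \<open>Keeping only the conditions for \<open>H\<close> can only enlarge the set, and any extra
  \<open>n\<close> has a multiple of some \<open>l\<close> outside \<open>H\<close> in
  \<open>(n, n + 2)\<close>. The union bound applies, with
  \<open>2 * (N + 2) \<le> 6 * N\<close>.\<close>

lemma card_B_set_approx: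
  assumes k: "k \<ge> 2" and fin: "finite I" "finite J" and sub: "I \<subseteq> Lambda k" "J \<subseteq> Lambda k" and disj: "I \<inter> J = {}"
    and H: "H \<subseteq> Lambda k" "I \<union> J \<subseteq> H"
    and tail: "\<And>F. finite F \<Longrightarrow> F \<subseteq> Lambda k - H \<Longrightarrow> (\<Sum>l\<in>F. 1 / l) \<le> \<epsilon>"
    and N: "N \<ge> 1"
  shows "\<bar>real (card {n \<in> {1..N}. n \<in> B_set k I J}) / real N -
    real (card {n \<in> {1..N}. \<forall>l\<in>H. frac (real n * (1 / l)) \<in> target_arc I J l}) / real N\<bar> \<le> 6 * \<epsilon>"
proof -
  define B where "B = {n \<in> {1..N}. n \<in> B_set k I J}"
  define BH where "BH = {n \<in> {1..N}. \<forall>l\<in>H. frac (real n * (1 / l)) \<in> target_arc I J l}"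
  define T where "T = {n \<in> {1..N}. \<exists>l\<in>Lambda k - H. \<exists>a::nat. a \<ge> 1 \<and> real n < real a * l \<and> real a * l < real n + 2}"
  have fins: "finite B" "finite BH" "finite T" by (simp_all add: B_def BH_def T_def)
  have "B \<subseteq> BH" using H by (auto simp: B_def BH_def B_set_iff_frac[OF k fin sub disj])
  moreover have "BH \<subseteq> B \<union> T"
  proof
    fix n assume n: "n \<in> BH"
    show "n \<in> B \<union> T"
    proof (cases "n \<in> B")
      case False
      then obtain l where l: "l \<in> Lambda k" "frac (real n * (1 / l)) \<notin> target_arc I J l"
        using n by (auto simp: B_def BH_def B_set_iff_frac[OF k fin sub disj])
      then have lH: "l \<in> Lambda k - H" using n by (auto simp: BH_def)
      have l2: "l > 2" using Lambda_gt_2(1)[OF l(1) k] .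
      have "1 - 2 / l < frac (real n * (1 / l))"
      proof -
        have "l \<notin> I" "l \<notin> J" using lH H by auto
        then show ?thesis using l(2) by (simp add: target_arc_def not_le)
      qed
      then have "\<exists>a::nat. a \<ge> 1 \<and> real n < real a * l \<and> real a * l < real n + 2"
        using multiple_in_window_iff_frac[of l 0 2 n] l2 frac_lt_1[of "real n * (1 / l)"] by simp
      then show ?thesis using lH n by (auto simp: T_def BH_def)
    qed simp
  qed
  ultimately have c: "card B \<le> card BH" "card BH \<le> card B + card T"
    using fins by (auto intro: card_mono order.trans[OF card_mono card_Un_le])
  have "real (card T) \<le> 2 * (real N + 2) * \<epsilon>"
    unfolding T_def by (rule card_hit_by_tail_le) (use tail Lambda_gt_2(1)[OF _ k] in \<open>force+\<close>)
  moreover have "\<epsilon> \<ge> 0" using tail[of "{}"] by simp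
  then have "2 * (real N + 2) * \<epsilon> \<le> 6 * real N * \<epsilon>" using N by (intro mult_right_mono) auto
  ultimately have "\<bar>real (card B) - real (card BH)\<bar> \<le> 6 * \<epsilon> * real N" using c by (simp add: mult_ac)
  then have "\<bar>real (card B) - real (card BH)\<bar> / real N \<le> 6 * \<epsilon>" using N by (simp add: field_simps)
  then show ?thesis unfolding B_def[symmetric] BH_def[symmetric]
    by (simp add: abs_divide flip: diff_divide_distrib)
qed

lemma B_set_mean:
  assumes k: "k \<ge> 2" and fin: "finite I" "finite J" and sub: "I \<subseteq> Lambda k" "J \<subseteq> Lambda k" and disj: "I \<inter> J = {}"
    and P: "has_prod_set (\<lambda>l. 1 - 2 / l) (Lambda k - (I \<union> J)) P"
  shows "(\<lambda>N. real (card {n \<in> {1..N}. n \<in> B_set k I J}) / real N) \<longlonglongrightarrow> (\<Prod>l\<in>I \<union> J. 1 / l) * P"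
proof (rule LIMSEQ_I)
  fix r :: real assume r: "r > 0"
  \<comment> \<open>The errors are \<open>6 * \<epsilon>\<close> from the tail,
    \<open>\<epsilon>\<close> from equidistribution and \<open>\<epsilon>\<close> from truncating
    the product, in total less than \<open>9 * \<epsilon>\<close>.\<close>
  define \<epsilon> where "\<epsilon> = r / 9"
  have \<epsilon>: "\<epsilon> > 0" using r by (simp add: \<epsilon>_def)
  define K where "K = I \<union> J"
  define D where "D = (\<Prod>l\<in>K. 1 / l)"
  have pos: "l > 2" if "l \<in> Lambda k" for l using Lambda_gt_2(1)[OF that k] .
  have K: "K \<subseteq> Lambda k" "finite K" using sub fin by (auto simp: K_def)
  have D01: "0 \<le> D" "D \<le> 1"
  proof -
    have "0 \<le> 1 / l \<and> 1 / l \<le> 1" if "l \<in> K" for l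
      using pos[of l] that K by auto
    then show "0 \<le> D" "D \<le> 1" unfolding D_def by (auto intro!: prod_nonneg prod_le_1)
  qed
  have "\<forall>\<^sub>F F in finite_subsets_at_top (Lambda k - K). dist (\<Prod>l\<in>F. 1 - 2 / l) P < \<epsilon>"
    using P \<epsilon> unfolding has_prod_set_def K_def by (rule tendstoD)
  then obtain F1 where F1: "finite F1" "F1 \<subseteq> Lambda k - K"
      "\<And>F. finite F \<Longrightarrow> F1 \<subseteq> F \<Longrightarrow> F \<subseteq> Lambda k - K \<Longrightarrow> dist (\<Prod>l\<in>F. 1 - 2 / l) P < \<epsilon>"
    unfolding eventually_finite_subsets_at_top by metis
  define R where "R = Lambda k - K"
  have summ: "(\<lambda>l. 1 / l) summable_on R"
    unfolding R_def by (rule summable_on_subset_banach[OF summable_on_inverse_Lambda[OF k]]) auto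
  define S where "S = infsum (\<lambda>l. 1 / l) R"
  have "((\<lambda>l. 1 / l) has_sum S) R" unfolding S_def using summ by (rule has_sum_infsum)
  then have "\<forall>\<^sub>F F in finite_subsets_at_top R. dist (\<Sum>l\<in>F. 1 / l) S < \<epsilon>"
    unfolding has_sum_def using \<epsilon> by (rule tendstoD)
  then obtain F2 where F2: "finite F2" "F2 \<subseteq> R"
      "\<And>F. finite F \<Longrightarrow> F2 \<subseteq> F \<Longrightarrow> F \<subseteq> R \<Longrightarrow> dist (\<Sum>l\<in>F. 1 / l) S < \<epsilon>"
    unfolding eventually_finite_subsets_at_top by metis
  \<comment> \<open>\<open>F1\<close> controls the product and \<open>F2\<close> the sum; both
    estimates persist for larger finite sets, so the union serves for both.\<close>
  define F where "F = F1 \<union> F2"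
  define H where "H = K \<union> F"
  have F: "finite F" "F \<subseteq> R" "F1 \<subseteq> F" "F2 \<subseteq> F" using F1 F2 by (auto simp: F_def R_def)
  have H: "finite H" "H \<subseteq> Lambda k" "I \<union> J \<subseteq> H" "H - (I \<union> J) = F"
    using K F by (auto simp: H_def R_def K_def)
  \<comment> \<open>The sum over \<open>F\<close> is already within \<open>\<epsilon>\<close> of the
    total \<open>S\<close>, and adjoining \<open>X\<close> cannot exceed \<open>S\<close>.\<close>
  have tail: "(\<Sum>l\<in>X. 1 / l) \<le> \<epsilon>" if X: "finite X" "X \<subseteq> Lambda k - H" for X
  proof -
    have XF: "X \<inter> F = {}" "X \<union> F \<subseteq> R" using X F by (auto simp: H_def R_def)
    have "(\<Sum>l\<in>X. 1 / l) + (\<Sum>l\<in>F. 1 / l) = (\<Sum>l\<in>X \<union> F. 1 / l)"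
      using X F XF by (intro sum.union_disjoint[symmetric]) auto
    also have "\<dots> \<le> S" unfolding S_def
      using summ X F XF pos by (intro finite_sum_le_infsum) (force simp: R_def)+
    finally show ?thesis using F2(3)[OF F(1,4,2)] by (simp add: dist_real_def)
  qed
  have "(\<lambda>N. real (card {n \<in> {1..N}. \<forall>l\<in>H. frac (real n * (1 / l)) \<in> target_arc I J l}) / real N)
      \<longlonglongrightarrow> D * (\<Prod>l\<in>F. 1 - 2 / l)"
    using target_arc_equidistribution[OF k H(1-3)] unfolding H(4) D_def K_def .
  from LIMSEQ_D[OF this \<epsilon>] obtain N0 where N0: "\<And>N. N \<ge> N0 \<Longrightarrow>
      norm (real (card {n \<in> {1..N}. \<forall>l\<in>H. frac (real n * (1 / l)) \<in> target_arc I J l}) / real N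
        - D * (\<Prod>l\<in>F. 1 - 2 / l)) < \<epsilon>" by blast
  have "\<bar>D * (\<Prod>l\<in>F. 1 - 2 / l) - D * P\<bar> = D * \<bar>(\<Prod>l\<in>F. 1 - 2 / l) - P\<bar>"
    using D01 by (simp add: abs_mult flip: right_diff_distrib)
  also have "\<dots> \<le> 1 * \<epsilon>"
    using D01 F1(3)[OF F(1,3)] F(2) by (intro mult_mono) (auto simp: dist_real_def R_def)
  finally have DP: "\<bar>D * (\<Prod>l\<in>F. 1 - 2 / l) - D * P\<bar> \<le> \<epsilon>" by simp
  show "\<exists>no. \<forall>N\<ge>no. norm (real (card {n \<in> {1..N}. n \<in> B_set k I J}) / real N - (\<Prod>l\<in>I \<union> J. 1 / l) * P) < r"
  proof (intro exI allI impI)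
    fix N assume N: "N \<ge> max 1 N0"
    have "\<bar>real (card {n \<in> {1..N}. n \<in> B_set k I J}) / real N -
      real (card {n \<in> {1..N}. \<forall>l\<in>H. frac (real n * (1 / l)) \<in> target_arc I J l}) / real N\<bar> \<le> 6 * \<epsilon>"
      by (rule card_B_set_approx[OF k fin sub disj H(2,3) tail]) (use N in auto)
    moreover have "\<bar>real (card {n \<in> {1..N}. \<forall>l\<in>H. frac (real n * (1 / l)) \<in> target_arc I J l}) / real N
        - D * (\<Prod>l\<in>F. 1 - 2 / l)\<bar> < \<epsilon>"
      using N0[of N] N by simp
    ultimately have "\<bar>real (card {n \<in> {1..N}. n \<in> B_set k I J}) / real N - D * P\<bar> < 9 * \<epsilon>"
      using DP \<epsilon> by linarith
    then show "norm (real (card {n \<in> {1..N}. n \<in> B_set k I J}) / real N - (\<Prod>l\<in>I \<union> J. 1 / l) * P) < r"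
      by (simp add: \<epsilon>_def D_def K_def)
  qed
qed

theorem theorem1:
  fixes k :: nat and I J :: "real set"
  assumes "k \<ge> 2"
    and "finite I" and "finite J"
    and "I \<subseteq> Lambda k" and "J \<subseteq> Lambda k"
    and "I \<inter> J = {}"
  shows "\<exists>P. has_prod_set (\<lambda>l. 1 - 2 / l) (Lambda k - (I \<union> J)) P \<and>
           has_density (B_set k I J) ((\<Prod>l\<in>I \<union> J. 1 / l) * P) \<and>
           (\<Prod>l\<in>I \<union> J. 1 / l) * P > 0"
proof -
  obtain P where P: "has_prod_set (\<lambda>l. 1 - 2 / l) (Lambda k - (I \<union> J)) P" "P > 0"
    using has_prod_set_Lambda[OF assms(1), of "Lambda k - (I \<union> J)"] by blast
  have "0 \<notin> B_set k I J" by (simp add: B_set_def)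
  then have "has_density (B_set k I J) ((\<Prod>l\<in>I \<union> J. 1 / l) * P)"
    using B_set_mean[OF assms P(1)] by (intro has_density_sequentially)
  moreover have "(\<Prod>l\<in>I \<union> J. 1 / l) > 0"
  proof (rule prod_pos)
    show "0 < 1 / l" if "l \<in> I \<union> J" for l using Lambda_gt_2(1)[of l k] that assms by auto
  qed
  ultimately show ?thesis using P by auto
qed

end
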